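(* Let $d\le m$ be positive integers, let $f:\mathbb{R}_{\geq 0}\to\mathbb{R}_{\geq 0}$ be a convex function, and for a sequence $\mathcal{F}=\{\phi_i\}_{i=1}^m\subset\mathbb{C}^d$ put $P_f(\mathcal{F})=\operatorname{tr}(f(S^{\mathcal{F}}))$. Let $c>0$ and let $\mathbf{a}=(a_i)_{i=1}^m$ be a non-increasing finite sequence of positive real numbers. Then: (a) If $\mathcal{F}\in\mathcal{A}(c)$ is a tight frame for $\mathbb{C}^d$, then $\mathcal{F}$ is a global minimizer of $P_f$ in $\mathcal{A}(c)$. If moreover $f$ is strictly convex, then every global minimizer of $P_f$ in $\mathcal{A}(c)$ is a tight frame. (b) If $\mathcal{F}\in\mathcal{B}(\mathbf{a})$ is of the form $$\{\sqrt{a_i}\,e_i\}_{i=1}^r\cup\{\phi_i\}_{i=r+1}^m, \qquad ( * )$$ where $\{e_i\}_{i=1}^d$ is an orthonormal basis of $\mathbb{C}^d$, $r=r_d(\mathbf{a})$ is the $d$-irregularity of $\mathbf{a}$, and $\{\phi_i\}_{i=r+1}^m$ is a tight frame for $\operatorname{span}\{e_i\}_{i=r+1}^d$, then $\mathcal{F}$ is a global minimizer of $P_f$ in $\mathcal{B}(\mathbf{a})$. If moreover $f$ is strictly convex, then every global minimizer of $P_f$ in $\mathcal{B}(\mathbf{a})$ is of the form $( * )$ for some orthonormal basis $\{e_i\}_{i=1}^d$ of $\mathbb{C}^d$.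
   Context: For a finite sequence $\mathcal{F}=\{\phi_i\}_{i=1}^m\subset\mathbb{C}^d$, the synthesis operator is $T^{\mathcal{F}}:\mathbb{C}^m\to\mathbb{C}^d$, $T^{\mathcal{F}}e_i=\phi_i$ ($\{e_i\}$ here being the canonical basis of $\mathbb{C}^m$), and the frame operator is $S^{\mathcal{F}}=T^{\mathcal{F}}(T^{\mathcal{F}})^*$, a positive semidefinite $d\times d$ matrix; $f(S^{\mathcal{F}})$ is defined by functional calculus, so $P_f(\mathcal{F})=\sum_{i=1}^d f(\lambda_i)$ where $\lambda_1,\dots,\lambda_d$ are the eigenvalues of $S^{\mathcal{F}}$ counted with multiplicity. A sequence $\{\phi_i\}_i$ in a subspace $W$ is a tight frame for $W$ if there is $\alpha>0$ with $\sum_i|\langle x,\phi_i\rangle|^2=\alpha\|x\|^2$ for all $x\in W$; "tight frame" without further mention means tight frame for $\mathbb{C}^d$. $\mathcal{A}(c)=\{\{\phi_i\}_{i=1}^m\subset\mathbb{C}^d:\ \sum_{i=1}^m\|\phi_i\|^2=c\}$ and $\mathcal{B}(\mathbf{a})=\{\{\phi_i\}_{i=1}^m\subset\mathbb{C}^d:\ \|\phi_i\|^2=a_i\text{ for every }i\}$. The $d$-irregularity of a non-increasing positive sequence $\mathbf{a}=(a_i)_{i=1}^m$, $d\le m$, is $r_d(\mathbf{a})=\max\{1\le j\le d-1:\ (d-j)a_j>\sum_{i=j+1}^m a_i\}$ if this set is nonempty, and $r_d(\mathbf{a})=0$ otherwise. *)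

theory Defs
  imports
    "HOL-Analysis.Convex"
    "Jordan_Normal_Form.Schur_Decomposition"
    "Jordan_Normal_Form.VS_Connect"
begin

(* Finite sequences (x_i), i = 1..n, are functions on nat of which only the values on {1..n}
   matter; indices start at 1, whereas rows and columns of matrices are counted from 0. *)

definition strictly_convex_on :: "real set \<Rightarrow> (real \<Rightarrow> real) \<Rightarrow> bool" where
  "strictly_convex_on S f \<longleftrightarrow> convex S \<and>
     (\<forall>x\<in>S. \<forall>y\<in>S. \<forall>u>0. \<forall>v>0. x \<noteq> y \<longrightarrow> u + v = 1 \<longrightarrow>
        f (u * x + v * y) < u * f x + v * f y)"


section \<open>Complex vectors and Hermitian functional calculus\<close>

(* \<bullet>c is linear in its first and conjugate-linear in its second argument. *)

definition cvec_norm :: "complex vec \<Rightarrow> real" where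
  "cvec_norm v = sqrt (Re (v \<bullet>c v))"

abbreviation cspan :: "nat \<Rightarrow> complex vec set \<Rightarrow> complex vec set" where
  "cspan d \<equiv> LinearCombinations.module.span class_ring (module_vec TYPE(complex) d)"

definition orthonormal_basis :: "nat \<Rightarrow> (nat \<Rightarrow> complex vec) \<Rightarrow> bool" where
  "orthonormal_basis d e \<longleftrightarrow>
     (\<forall>i\<in>{1..d}. e i \<in> carrier_vec d) \<and>
     (\<forall>i\<in>{1..d}. \<forall>j\<in>{1..d}. e i \<bullet>c e j = (if i = j then 1 else 0)) \<and>
     cspan d (e ` {1..d}) = carrier_vec d"

definition unitary_mat :: "nat \<Rightarrow> complex mat \<Rightarrow> bool" where
  "unitary_mat n U \<longleftrightarrow> U \<in> carrier_mat n n \<and>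
     mat_adjoint U * U = 1\<^sub>m n \<and> U * mat_adjoint U = 1\<^sub>m n"

definition mat_trace :: "complex mat \<Rightarrow> complex" where
  "mat_trace A = (\<Sum>i<dim_row A. A $$ (i, i))"

definition unitary_diag :: "nat \<Rightarrow> complex mat \<Rightarrow> (nat \<Rightarrow> real) \<Rightarrow> complex mat" where
  "unitary_diag n U l = U * mat_diag n (\<lambda>i. complex_of_real (l i)) * mat_adjoint U"

(* f(A) for Hermitian A: if A = U diag(l) U^* with U unitary and l real,
   then f(A) = U diag(f o l) U^*.  By hermitian_fun_eqI the choice of the
   diagonalization is irrelevant. *)
definition hermitian_fun :: "(real \<Rightarrow> real) \<Rightarrow> complex mat \<Rightarrow> complex mat" where
  "hermitian_fun f A = (THE B. \<exists>U l. unitary_mat (dim_row A) U \<and>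
     A = unitary_diag (dim_row A) U l \<and> B = unitary_diag (dim_row A) U (f \<circ> l))"

lemma mat_adjoint_carrier [simp]:
  "A \<in> carrier_mat n k \<Longrightarrow> mat_adjoint A \<in> carrier_mat k n"
  unfolding mat_adjoint_def by auto

lemma unitary_diag_unique:
  assumes U: "unitary_mat n U" and V: "unitary_mat n V"
    and eq: "unitary_diag n U l = unitary_diag n V k"
  shows "unitary_diag n U (f \<circ> l) = unitary_diag n V (f \<circ> k)"
proof -
  let ?D = "\<lambda>g. mat_diag n (\<lambda>i. complex_of_real (g i))"
  let ?U' = "mat_adjoint U" and ?V' = "mat_adjoint V"
  define W where "W = ?V' * U"
  have c: "U \<in> carrier_mat n n" "V \<in> carrier_mat n n"
    "?U' \<in> carrier_mat n n" "?V' \<in> carrier_mat n n"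
    and UU: "?U' * U = 1\<^sub>m n" "U * ?U' = 1\<^sub>m n" and VV: "?V' * V = 1\<^sub>m n" "V * ?V' = 1\<^sub>m n"
    using U V by (auto simp: unitary_mat_def)
  have W: "W \<in> carrier_mat n n" unfolding W_def using c by (intro mult_carrier_mat)
  have D: "?D g \<in> carrier_mat n n" for g by simp
  note assoc = assoc_mult_mat[of _ n n _ n _ n] mult_carrier_mat[of _ n n _ n]
  have VW: "V * W = U"
  proof -
    have "V * W = (V * ?V') * U" unfolding W_def using c by (simp add: assoc)
    thus ?thesis using VV c by simp
  qed
  have WU: "W * ?U' = ?V'"
  proof -
    have "W * ?U' = ?V' * (U * ?U')" unfolding W_def using c by (simp add: assoc)
    thus ?thesis using UU c by simp
  qed
  have "W * ?D l = ?V' * (unitary_diag n U l) * U"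
  proof -
    have "?V' * (U * ?D l * ?U') * U = ?V' * U * ?D l * (?U' * U)"
      using c D by (simp add: assoc)
    thus ?thesis using UU(1) right_mult_one_mat[OF mult_carrier_mat[OF W D]]
      by (simp add: unitary_diag_def W_def)
  qed
  also have "\<dots> = ?D k * W"
  proof -
    have "?V' * (V * ?D k * ?V') * U = (?V' * V) * ?D k * (?V' * U)"
      using c D by (simp add: assoc)
    thus ?thesis using eq VV(1) left_mult_one_mat[OF D]
      by (simp add: unitary_diag_def W_def)
  qed
  finally have comm: "W * ?D l = ?D k * W" .
  have "W * ?D (f \<circ> l) = ?D (f \<circ> k) * W"
  proof (rule eq_matI)
    fix i j assume "i < dim_row (?D (f \<circ> k) * W)" "j < dim_col (?D (f \<circ> k) * W)"
    hence ij: "i < n" "j < n" using W by (auto simp: mat_diag_def)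
    have "(W * ?D l) $$ (i, j) = (?D k * W) $$ (i, j)" by (simp only: comm)
    hence "W $$ (i, j) * of_real (l j) = of_real (k i) * W $$ (i, j)"
      using W ij by (simp add: mat_diag_mult_left[OF W] mat_diag_mult_right[OF W])
    hence "W $$ (i, j) = 0 \<or> l j = k i" by (auto simp: mult.commute)
    thus "(W * ?D (f \<circ> l)) $$ (i, j) = (?D (f \<circ> k) * W) $$ (i, j)"
      using W ij by (auto simp: mat_diag_mult_left[OF W] mat_diag_mult_right[OF W])
  qed (use W in \<open>auto simp: mat_diag_def\<close>)
  hence "V * (W * ?D (f \<circ> l)) * ?U' = V * (?D (f \<circ> k) * W) * ?U'" by simp
  moreover have "V * (W * ?D (f \<circ> l)) * ?U' = (V * W) * ?D (f \<circ> l) * ?U'"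
    using c W D by (simp add: assoc)
  moreover have "V * (?D (f \<circ> k) * W) * ?U' = V * ?D (f \<circ> k) * (W * ?U')"
    using c W D by (simp add: assoc)
  ultimately show ?thesis by (simp add: unitary_diag_def VW WU)
qed

lemma hermitian_fun_eqI:
  assumes "unitary_mat n U" and "A = unitary_diag n U l"
  shows "hermitian_fun f A = unitary_diag n U (f \<circ> l)"
proof -
  have n: "dim_row A = n" using assms by (auto simp: unitary_diag_def unitary_mat_def)
  show ?thesis unfolding hermitian_fun_def n
    by (rule the_equality) (use assms unitary_diag_unique in blast)+
qed

lemma mat_trace_hermitian_fun:
  assumes U: "unitary_mat n U" and A: "A = unitary_diag n U l"
  shows "mat_trace (hermitian_fun f A) = complex_of_real (\<Sum>i<n. f (l i))"
proof -
  have c: "U \<in> carrier_mat n n" and c': "mat_adjoint U \<in> carrier_mat n n"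
    using U by (auto simp: unitary_mat_def)
  define U' where "U' = mat_adjoint U"
  note c'' = c'[folded U'_def]
  have UU: "(\<Sum>i<n. U' $$ (j, i) * U $$ (i, j)) = 1" if "j < n" for j
  proof -
    have "(U' * U) $$ (j, j) = 1" using U that by (simp add: unitary_mat_def U'_def)
    moreover have "(U' * U) $$ (j, j) = (\<Sum>i<n. U' $$ (j, i) * U $$ (i, j))"
      using c c'' that by (auto simp: scalar_prod_def atLeast0LessThan intro!: sum.cong)
    ultimately show ?thesis by simp
  qed
  have "mat_trace (hermitian_fun f A) =
      (\<Sum>i<n. \<Sum>j<n. U $$ (i, j) * of_real (f (l j)) * U' $$ (j, i))"
    unfolding hermitian_fun_eqI[OF assms] unitary_diag_def mat_trace_def U'_def[symmetric]
      mat_diag_mult_right[OF c]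
    using c c'' by (simp add: scalar_prod_def atLeast0LessThan)
  also have "\<dots> = (\<Sum>j<n. of_real (f (l j)) * (\<Sum>i<n. U' $$ (j, i) * U $$ (i, j)))"
    by (subst sum.swap) (simp add: sum_distrib_left mult_ac)
  also have "\<dots> = of_real (\<Sum>j<n. f (l j))" by (simp add: UU)
  finally show ?thesis .
qed

lemma char_poly_unitary_diag:
  assumes U: "unitary_mat n U"
  shows "char_poly (unitary_diag n U l) = (\<Prod>i\<leftarrow>[0..<n]. [:- complex_of_real (l i), 1:])"
proof -
  let ?D = "mat_diag n (\<lambda>i. complex_of_real (l i))"
  have c: "U \<in> carrier_mat n n" and c': "mat_adjoint U \<in> carrier_mat n n"
    and UU: "mat_adjoint U * U = 1\<^sub>m n" "U * mat_adjoint U = 1\<^sub>m n"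
    using U by (auto simp: unitary_mat_def)
  have "similar_mat (unitary_diag n U l) ?D"
    unfolding similar_mat_def similar_mat_wit_def unitary_diag_def
    by (rule exI[of _ U], rule exI[of _ "mat_adjoint U"]) (use c c' UU in \<open>auto simp: Let_def intro!: mult_carrier_mat[of _ n n _ n]\<close>)
  hence "char_poly (unitary_diag n U l) = char_poly ?D" by (rule char_poly_similar)
  also have "\<dots> = (\<Prod>a\<leftarrow>diag_mat ?D. [:- a, 1:])"
    by (rule char_poly_upper_triangular[of _ n]) (auto simp: mat_diag_def)
  also have "diag_mat ?D = map (\<lambda>i. complex_of_real (l i)) [0..<n]"
    by (auto simp: diag_mat_def mat_diag_def)
  finally show ?thesis by (simp add: o_def)
qed


section \<open>Frames\<close>

definition synthesis_mat :: "nat \<Rightarrow> nat \<Rightarrow> (nat \<Rightarrow> complex vec) \<Rightarrow> complex mat" where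
  "synthesis_mat d m F = mat_of_cols d (map F [1..<Suc m])"

definition frame_op :: "nat \<Rightarrow> nat \<Rightarrow> (nat \<Rightarrow> complex vec) \<Rightarrow> complex mat" where
  "frame_op d m F = synthesis_mat d m F * mat_adjoint (synthesis_mat d m F)"

definition frame_potential ::
    "nat \<Rightarrow> nat \<Rightarrow> (real \<Rightarrow> real) \<Rightarrow> (nat \<Rightarrow> complex vec) \<Rightarrow> real" where
  "frame_potential d m f F = Re (mat_trace (hermitian_fun f (frame_op d m F)))"

definition tight_frame :: "complex vec set \<Rightarrow> nat set \<Rightarrow> (nat \<Rightarrow> complex vec) \<Rightarrow> bool" where
  "tight_frame W I F \<longleftrightarrow> (\<forall>i\<in>I. F i \<in> W) \<and>
     (\<exists>\<alpha>>0. \<forall>x\<in>W. (\<Sum>i\<in>I. (cmod (x \<bullet>c F i))\<^sup>2) = \<alpha> * (cvec_norm x)\<^sup>2)"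

definition total_norm_seqs :: "nat \<Rightarrow> nat \<Rightarrow> real \<Rightarrow> (nat \<Rightarrow> complex vec) set" where
  "total_norm_seqs d m c =
     {F. (\<forall>i\<in>{1..m}. F i \<in> carrier_vec d) \<and> (\<Sum>i=1..m. (cvec_norm (F i))\<^sup>2) = c}"

definition prescribed_norm_seqs ::
    "nat \<Rightarrow> nat \<Rightarrow> (nat \<Rightarrow> real) \<Rightarrow> (nat \<Rightarrow> complex vec) set" where
  "prescribed_norm_seqs d m a =
     {F. \<forall>i\<in>{1..m}. F i \<in> carrier_vec d \<and> (cvec_norm (F i))\<^sup>2 = a i}"

definition irregularity :: "nat \<Rightarrow> nat \<Rightarrow> (nat \<Rightarrow> real) \<Rightarrow> nat" where
  "irregularity d m a =
     (let J = {j. 1 \<le> j \<and> j \<le> d - 1 \<and> real (d - j) * a j > (\<Sum>i=j+1..m. a i)}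
      in if J = {} then 0 else Max J)"

definition canonical_form ::
    "nat \<Rightarrow> nat \<Rightarrow> (nat \<Rightarrow> real) \<Rightarrow> (nat \<Rightarrow> complex vec) \<Rightarrow> (nat \<Rightarrow> complex vec) \<Rightarrow> bool" where
  "canonical_form d m a e F \<longleftrightarrow>
     (let r = irregularity d m a in
        (\<forall>i\<in>{1..r}. F i = complex_of_real (sqrt (a i)) \<cdot>\<^sub>v e i) \<and>
        tight_frame (cspan d (e ` {r+1..d})) {r+1..m} F)"

end

theory Submission
  imports Defs "Jordan_Normal_Form.Spectral_Radius"
begin

text \<open>
  Both parts compare the eigenvalues of the frame operator \<open>S\<close> with an explicit optimal spectrum \<open>\<mu>\<close>:
  the constant \<open>c / d\<close> in the first part, and \<open>a 1, \<dots>, a r, b, \<dots>, b\<close> in the second, where \<open>b\<close> is the sum of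
  \<open>a (r+1), \<dots>, a m\<close> divided by \<open>d - r\<close>. The irregularity \<open>r\<close> is exactly the index that makes \<open>\<mu>\<close>
  decreasing while \<open>b\<close> still dominates the remaining norms (\<open>irregularity_properties\<close>).

  Lower bound. Let \<open>u\<close> be any orthonormal basis, and let \<open>\<delta> i\<close> be the diagonal entry \<open>\<langle>S (u i), u i\<rangle>\<close>. It is an
  average of the eigenvalues with weights forming a doubly stochastic matrix. Averaging the tangent
  inequalities of \<open>f\<close> at the points \<open>\<mu> i\<close> and summing by parts shows that the potential is at least the
  sum of the \<open>f (\<mu> i)\<close>, as soon as the partial sums of \<open>\<delta>\<close> dominate those of \<open>\<mu>\<close> up to \<open>r\<close> and the totals
  agree (\<open>doubly_stochastic_convex_bound\<close>, \<open>frame_potential_lower_bound\<close>). For prescribed norms this is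
  achieved by a basis in which the first frame vectors are triangular: then the first \<open>j\<close> vectors already
  contribute \<open>a 1 + \<dots> + a j\<close> to the first \<open>j\<close> diagonal entries (\<open>flag_basis_exists\<close>,
  \<open>flag_basis_partial_sums\<close>). The tangent inequalities exist because all \<open>\<mu> i\<close> are positive.

  Attainment. A tight frame, or a frame of the form in the second part, has the optimal spectrum
  (\<open>canonical_frame_quad\<close>), so it is a minimizer (\<open>frame_potential_upper_bound\<close>).

  Uniqueness. To see that an arbitrary minimizer has no more than the optimal value, frames with the
  optimal spectrum must exist. They come from scaled basis vectors by rotating pairs of vectors, which
  changes their norms but not \<open>S\<close> (\<open>prescribed_norm_frame_exists\<close>). If \<open>f\<close> is strictly convex, equality in
  the lower bound forces \<open>u\<close> to diagonalize \<open>S\<close> with eigenvalues \<open>\<mu>\<close>. Equality in the partial sums then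
  says that the first \<open>r\<close> frame vectors are multiples of \<open>u 1, \<dots>, u r\<close> and that all later ones are
  orthogonal to them, which is the asserted form (\<open>canonical_form_of_spectrum\<close>).
\<close>

section \<open>Orthonormal families in complex coordinate space\<close>

definition orthonormal_on :: "nat \<Rightarrow> nat set \<Rightarrow> (nat \<Rightarrow> complex vec) \<Rightarrow> bool" where
  "orthonormal_on d I u \<longleftrightarrow> (\<forall>i\<in>I. u i \<in> carrier_vec d) \<and>
     (\<forall>i\<in>I. \<forall>j\<in>I. u i \<bullet>c u j = (if i = j then 1 else 0))"

lemma cinner_sum:
  assumes "y \<in> carrier_vec d"
  shows "x \<bullet>c y = (\<Sum>p<d. x $ p * cnj (y $ p))"
  using assms by (auto simp: scalar_prod_def atLeast0LessThan intro!: sum.cong)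

lemma cinner_commute:
  assumes "x \<in> carrier_vec d" "y \<in> carrier_vec d"
  shows "y \<bullet>c x = cnj (x \<bullet>c y)"
  using assms by (simp add: cinner_sum[where d = d] mult.commute)

lemma cmod_cinner_commute:
  assumes "x \<in> carrier_vec d" "y \<in> carrier_vec d"
  shows "cmod (y \<bullet>c x) = cmod (x \<bullet>c y)"
  using cinner_commute[OF assms] by simp

lemma cinner_self: "x \<bullet>c x = of_real ((cvec_norm x)\<^sup>2)"
proof -
  have s: "x \<bullet>c x = of_real (\<Sum>p<dim_vec x. (cmod (x $ p))\<^sup>2)"
    using cinner_sum[of x "dim_vec x" x] by (simp add: complex_norm_square del: of_real_power)
  then have "Re (x \<bullet>c x) \<ge> 0" by (simp add: sum_nonneg)
  then show ?thesis using s by (simp add: cvec_norm_def)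
qed

lemma cvec_norm_sq:
  assumes "x \<in> carrier_vec d"
  shows "(cvec_norm x)\<^sup>2 = (\<Sum>p<d. (cmod (x $ p))\<^sup>2)"
proof -
  have "of_real ((cvec_norm x)\<^sup>2) = complex_of_real (\<Sum>p<d. (cmod (x $ p))\<^sup>2)"
    unfolding cinner_self[symmetric] by (simp add: cinner_sum[OF assms] complex_norm_square del: of_real_power)
  then show ?thesis using of_real_eq_iff by blast
qed

lemma cinner_smult:
  assumes "x \<in> carrier_vec d" "y \<in> carrier_vec d"
  shows "(c \<cdot>\<^sub>v x) \<bullet>c y = c * (x \<bullet>c y)" "x \<bullet>c (c \<cdot>\<^sub>v y) = cnj c * (x \<bullet>c y)"
  using assms by (simp_all add: cinner_sum[where d = d] sum_distrib_left mult_ac)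

lemma cvec_norm_smult:
  assumes "x \<in> carrier_vec d"
  shows "(cvec_norm (c \<cdot>\<^sub>v x))\<^sup>2 = (cmod c)\<^sup>2 * (cvec_norm x)\<^sup>2"
  using assms by (simp add: cvec_norm_sq[where d = d] sum_distrib_left norm_mult power_mult_distrib)

lemma vec_eq_0_if_cvec_norm_0:
  assumes "x \<in> carrier_vec d" "(cvec_norm x)\<^sup>2 = 0"
  shows "x = 0\<^sub>v d"
  using assms by (auto simp: cvec_norm_sq[where d = d] sum_nonneg_eq_0_iff intro!: eq_vecI)

lemma cvec_norm_sq_eq_1: "x \<bullet>c x = 1 \<Longrightarrow> (cvec_norm x)\<^sup>2 = 1"
  using cinner_self[of x] by (metis of_real_eq_1_iff)

lemma cinner_unit_vec:
  fixes y :: "complex vec"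
  assumes "p < d"
  shows "y \<bullet>c unit_vec d p = y $ p"
  using assms by (simp add: cinner_sum[of _ d] unit_vec_def if_distrib cong: if_cong)

lemma unit_vec_cinner:
  assumes "p < d" "y \<in> carrier_vec d"
  shows "unit_vec d p \<bullet>c y = cnj (y $ p)"
  using cinner_unit_vec[OF assms(1)] cinner_commute[OF assms(2), of "unit_vec d p"] by simp

text \<open>A square matrix with orthonormal columns also has orthonormal rows, because a one-sided inverse
of a square matrix is two-sided. Completeness of the family, hence Parseval's identity, follows
from this alone.\<close>

lemma orthonormal_on_dual:
  assumes u: "orthonormal_on d {1..d} u" and p: "p < d" and q: "q < d"
  shows "(\<Sum>i=1..d. u i $ p * cnj (u i $ q)) = (if p = q then 1 else 0)"
proof -
  define U where "U = mat d d (\<lambda>(p,i). u (Suc i) $ p)"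
  define V where "V = mat d d (\<lambda>(i,p). cnj (u (Suc i) $ p))"
  have c: "U \<in> carrier_mat d d" "V \<in> carrier_mat d d" by (auto simp: U_def V_def)
  have "V * U = 1\<^sub>m d"
  proof (rule eq_matI)
    fix i j assume "i < dim_row (1\<^sub>m d)" "j < dim_col (1\<^sub>m d)"
    then have ij: "i < d" "j < d" by auto
    have s: "Suc i \<in> {1..d}" "Suc j \<in> {1..d}" using ij by auto
    have "(V * U) $$ (i, j) = (\<Sum>p<d. cnj (u (Suc i) $ p) * u (Suc j) $ p)"
      using ij by (simp add: U_def V_def scalar_prod_def atLeast0LessThan)
    also have "\<dots> = u (Suc j) \<bullet>c u (Suc i)"
      using u s by (simp add: cinner_sum[of _ d] orthonormal_on_def mult.commute)
    also have "\<dots> = (if i = j then 1 else 0)"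
      using u s unfolding orthonormal_on_def by auto
    finally show "(V * U) $$ (i, j) = 1\<^sub>m d $$ (i, j)" using ij by auto
  qed (auto simp: U_def V_def)
  then have "U * V = 1\<^sub>m d" by (rule mat_mult_left_right_inverse[OF c(2,1)])
  moreover have "(U * V) $$ (p, q) = (\<Sum>i<d. u (Suc i) $ p * cnj (u (Suc i) $ q))"
    using p q by (simp add: U_def V_def scalar_prod_def atLeast0LessThan)
  moreover have "\<dots> = (\<Sum>i=1..d. u i $ p * cnj (u i $ q))"
    by (rule sum.reindex_bij_witness[of _ "\<lambda>i. i - 1" Suc]) auto
  ultimately show ?thesis using p q by simp
qed

lemma parseval_cinner:
  assumes u: "orthonormal_on d {1..d} u" and x: "x \<in> carrier_vec d" and y: "y \<in> carrier_vec d"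
  shows "(\<Sum>i=1..d. (x \<bullet>c u i) * (u i \<bullet>c y)) = x \<bullet>c y"
proof -
  have c: "u i \<in> carrier_vec d" if "i \<in> {1..d}" for i using u that by (auto simp: orthonormal_on_def)
  have "(\<Sum>i=1..d. (x \<bullet>c u i) * (u i \<bullet>c y)) =
    (\<Sum>i=1..d. \<Sum>p<d. \<Sum>q<d. (x $ p * cnj (y $ q)) * (u i $ q * cnj (u i $ p)))"
    using c y by (intro sum.cong refl) (simp add: cinner_sum[where d = d] sum_product mult_ac)
  also have "\<dots> = (\<Sum>p<d. \<Sum>q<d. \<Sum>i=1..d. (x $ p * cnj (y $ q)) * (u i $ q * cnj (u i $ p)))"
    by (subst sum.swap, rule sum.cong[OF refl], subst sum.swap) simp
  also have "\<dots> = (\<Sum>p<d. \<Sum>q<d. (x $ p * cnj (y $ q)) * (if q = p then 1 else 0))"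
    by (intro sum.cong refl, subst sum_distrib_left[symmetric], subst orthonormal_on_dual[OF u]) auto
  also have "\<dots> = (\<Sum>p<d. x $ p * cnj (y $ p))" by (simp add: if_distrib sum.delta cong: if_cong)
  finally show ?thesis using y by (simp add: cinner_sum[where d = d])
qed

lemma parseval_norm:
  assumes u: "orthonormal_on d {1..d} u" and x: "x \<in> carrier_vec d"
  shows "(\<Sum>i=1..d. (cmod (x \<bullet>c u i))\<^sup>2) = (cvec_norm x)\<^sup>2"
proof -
  have "(\<Sum>i=1..d. (x \<bullet>c u i) * (u i \<bullet>c x)) = complex_of_real (\<Sum>i=1..d. (cmod (x \<bullet>c u i))\<^sup>2)"
    unfolding of_real_sum
  proof (rule sum.cong[OF refl])
    fix i assume "i \<in> {1..d}"
    then have "u i \<in> carrier_vec d" using u by (auto simp: orthonormal_on_def)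
    from cinner_commute[OF x this]
    show "(x \<bullet>c u i) * (u i \<bullet>c x) = complex_of_real ((cmod (x \<bullet>c u i))\<^sup>2)"
      by (simp only: complex_norm_square)
  qed
  then have "complex_of_real (\<Sum>i=1..d. (cmod (x \<bullet>c u i))\<^sup>2) = of_real ((cvec_norm x)\<^sup>2)"
    using parseval_cinner[OF u x x] cinner_self by metis
  then show ?thesis using of_real_eq_iff by blast
qed

lemma vec_sum_orthonormal:
  assumes u: "orthonormal_on d {1..d} u" and x: "x \<in> carrier_vec d" and p: "p < d"
  shows "x $ p = (\<Sum>i=1..d. (x \<bullet>c u i) * u i $ p)"
  using parseval_cinner[OF u x, of "unit_vec d p"] by (simp add: cinner_unit_vec[OF p])

lemma cinner_lincomb:
  fixes y :: "complex vec"
  assumes "y \<in> carrier_vec d" "finite J"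
  shows "vec d (\<lambda>p. \<Sum>j\<in>J. c j * w j $ p) \<bullet>c y = (\<Sum>j\<in>J. c j * (w j \<bullet>c y))"
proof -
  have "vec d (\<lambda>p. \<Sum>j\<in>J. c j * w j $ p) \<bullet>c y = (\<Sum>p<d. \<Sum>j\<in>J. c j * (w j $ p * cnj (y $ p)))"
    using assms by (simp add: cinner_sum[of _ d] sum_distrib_right mult.assoc)
  also have "\<dots> = (\<Sum>j\<in>J. c j * (\<Sum>p<d. w j $ p * cnj (y $ p)))"
    by (subst sum.swap) (simp add: sum_distrib_left)
  finally show ?thesis using assms by (simp add: cinner_sum[of _ d])
qed

text \<open>Fewer than \<open>d\<close> linear conditions have a nonzero common solution: written as the rows of a square
matrix padded with zero rows, they give determinant 0.\<close>

lemma unit_vec_orthogonal_exists: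
  fixes A :: "complex vec set"
  assumes A: "finite A" "A \<subseteq> carrier_vec d" "card A < d"
  shows "\<exists>x\<in>carrier_vec d. x \<bullet>c x = 1 \<and> (\<forall>y\<in>A. y \<bullet>c x = 0 \<and> x \<bullet>c y = 0)"
proof -
  obtain ys where ys: "set ys = A" "length ys = card A"
    using A(1) finite_distinct_list distinct_card by metis
  define M where "M = mat d d (\<lambda>(i,p). if i < length ys then cnj (ys ! i $ p) else 0)"
  have M: "M \<in> carrier_mat d d" by (simp add: M_def)
  have "M = mat\<^sub>r d d (\<lambda>i. if i = d - 1 then 0\<^sub>v d else row M i)"
    using ys A(3) by (intro eq_matI) (auto simp: M_def)
  then have "det M = 0"
    using det_row_0[of "d - 1" d "row M"] A(3) M by fastforce
  then obtain v where v: "v \<in> carrier_vec d" "v \<noteq> 0\<^sub>v d" "M *\<^sub>v v = 0\<^sub>v d"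
    using det_0_iff_vec_prod_zero[OF M] by auto
  have vy: "v \<bullet>c y = 0" if "y \<in> A" for y
  proof -
    have "y \<in> set ys" using that ys(1) by simp
    then obtain i where i: "i < length ys" "y = ys ! i" unfolding in_set_conv_nth by blast
    have yc: "y \<in> carrier_vec d" using that A(2) by blast
    have id: "i < d" using i(1) ys(2) A(3) by linarith
    have "(M *\<^sub>v v) $ i = (\<Sum>p<d. cnj (y $ p) * v $ p)"
      unfolding i(2) using id i(1) v(1) by (simp add: M_def scalar_prod_def atLeast0LessThan)
    also have "\<dots> = v \<bullet>c y" unfolding cinner_sum[OF yc] by (simp add: mult.commute)
    finally show ?thesis using v(3) id by simp
  qed
  define x where "x = (1 / complex_of_real (cvec_norm v)) \<cdot>\<^sub>v v"
  have n0: "cvec_norm v \<noteq> 0" using v vec_eq_0_if_cvec_norm_0 by force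
  have x: "x \<in> carrier_vec d" using v by (simp add: x_def)
  have "(cvec_norm x)\<^sup>2 = 1"
    unfolding x_def cvec_norm_smult[OF v(1)] using n0 by (simp add: norm_divide power_divide)
  then have "x \<bullet>c x = 1" unfolding cinner_self by simp
  moreover have "x \<bullet>c y = 0" if "y \<in> A" for y
    using vy[OF that] cinner_smult(1)[OF v(1), of y] A(2) that by (auto simp: x_def)
  moreover have "y \<bullet>c x = 0" if "y \<in> A" for y
    using cinner_commute[OF x, of y] calculation(2)[OF that] A(2) that by auto
  ultimately show ?thesis using x by blast
qed

lemma orthonormal_on_insert:
  assumes u: "orthonormal_on d I u" and k: "k \<notin> I" and x: "x \<in> carrier_vec d" "x \<bullet>c x = 1"
    and o: "\<And>i. i \<in> I \<Longrightarrow> x \<bullet>c u i = 0"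
  shows "orthonormal_on d (insert k I) (u(k := x))"
proof -
  have "u i \<bullet>c x = 0" if "i \<in> I" for i
    using cinner_commute[OF x(1), of "u i"] o[OF that] u that by (auto simp: orthonormal_on_def)
  then show ?thesis using assms by (auto simp: orthonormal_on_def)
qed

lemma orthonormal_extend:
  assumes "orthonormal_on d {1..k} u" "k \<le> d"
  shows "\<exists>w. orthonormal_on d {1..d} w \<and> (\<forall>i\<in>{1..k}. w i = u i)"
  using assms
proof (induction "d - k" arbitrary: k u)
  case 0
  then show ?case by auto
next
  case (Suc n)
  have "card (u ` {1..k}) < d"
    using card_image_le[of "{1..k}" u] Suc.hyps(2) by simp
  moreover have "u ` {1..k} \<subseteq> carrier_vec d"
    using Suc.prems by (auto simp: orthonormal_on_def)
  ultimately obtain x where x: "x \<in> carrier_vec d" "x \<bullet>c x = 1"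
    "\<forall>y\<in>u ` {1..k}. y \<bullet>c x = 0 \<and> x \<bullet>c y = 0"
    using unit_vec_orthogonal_exists[of "u ` {1..k}" d] by blast
  have i: "insert (Suc k) {1..k} = {1..Suc k}" by auto
  have "orthonormal_on d (insert (Suc k) {1..k}) (u(Suc k := x))"
    using x Suc.prems by (intro orthonormal_on_insert) auto
  then have o: "orthonormal_on d {1..Suc k} (u(Suc k := x))" unfolding i .
  have k: "n = d - Suc k" "Suc k \<le> d" using Suc.hyps(2) by auto
  obtain w where w: "orthonormal_on d {1..d} w" "\<forall>i\<in>{1..Suc k}. w i = (u(Suc k := x)) i"
    using Suc.hyps(1)[OF k(1) o k(2)] by blast
  have "w i = u i" if "i \<in> {1..k}" for i using w(2)[rule_format, of i] that by simp
  then show ?case using w(1) by blast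
qed

section \<open>The frame operator and its spectral decomposition\<close>

text \<open>The sesquilinear form \<open>\<langle>S x, y\<rangle>\<close> of the frame operator \<open>S\<close>, and its quadratic form. All estimates
below are about \<open>\<langle>S x, x\<rangle>\<close>, which is also the left-hand side of the tight frame identity, so that
matrices are needed only to identify the potential in \<open>frame_spectral\<close>.\<close>

definition frame_form :: "nat \<Rightarrow> (nat \<Rightarrow> complex vec) \<Rightarrow> complex vec \<Rightarrow> complex vec \<Rightarrow> complex" where
  "frame_form m F x y = (\<Sum>i=1..m. (x \<bullet>c F i) * (F i \<bullet>c y))"

definition frame_quad :: "nat \<Rightarrow> (nat \<Rightarrow> complex vec) \<Rightarrow> complex vec \<Rightarrow> real" where
  "frame_quad m F x = (\<Sum>i=1..m. (cmod (x \<bullet>c F i))\<^sup>2)"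

lemma frame_form_self:
  assumes F: "\<forall>i\<in>{1..m}. F i \<in> carrier_vec d" and x: "x \<in> carrier_vec d"
  shows "frame_form m F x x = of_real (frame_quad m F x)"
  unfolding frame_form_def frame_quad_def of_real_sum
proof (rule sum.cong[OF refl])
  fix i assume "i \<in> {1..m}"
  with F have "F i \<in> carrier_vec d" by auto
  from cinner_commute[OF x this]
  show "(x \<bullet>c F i) * (F i \<bullet>c x) = complex_of_real ((cmod (x \<bullet>c F i))\<^sup>2)"
    by (simp only: complex_norm_square)
qed

lemma frame_form_commute:
  assumes F: "\<forall>i\<in>{1..m}. F i \<in> carrier_vec d" and x: "x \<in> carrier_vec d" and y: "y \<in> carrier_vec d"
  shows "frame_form m F y x = cnj (frame_form m F x y)"
  unfolding frame_form_def cnj_sum complex_cnj_mult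
proof (rule sum.cong[OF refl])
  fix i assume "i \<in> {1..m}"
  with F have Fi: "F i \<in> carrier_vec d" by auto
  show "(y \<bullet>c F i) * (F i \<bullet>c x) = cnj (x \<bullet>c F i) * cnj (F i \<bullet>c y)"
    unfolding cinner_commute[OF x Fi] cinner_commute[OF Fi y] by simp
qed

lemma frame_form_lincomb:
  assumes F: "\<forall>i\<in>{1..m}. F i \<in> carrier_vec d" and "finite J"
  shows "frame_form m F (vec d (\<lambda>p. \<Sum>j\<in>J. c j * w j $ p)) y = (\<Sum>j\<in>J. c j * frame_form m F (w j) y)"
proof -
  have "frame_form m F (vec d (\<lambda>p. \<Sum>j\<in>J. c j * w j $ p)) y
    = (\<Sum>i=1..m. \<Sum>j\<in>J. c j * ((w j \<bullet>c F i) * (F i \<bullet>c y)))"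
    unfolding frame_form_def using assms
    by (intro sum.cong refl) (simp add: cinner_lincomb sum_distrib_right mult.assoc)
  then show ?thesis
    by (subst (asm) sum.swap) (simp add: frame_form_def sum_distrib_left)
qed

text \<open>The orthogonal complement of eigenvectors of a Hermitian operator is invariant. Therefore an
eigenvector of the compression to the complement, written in the remaining basis vectors
\<open>w (k+1), \<dots>, w d\<close>, is an eigenvector of the operator itself. The eigenvalue is a Rayleigh quotient
and hence real.\<close>

lemma frame_form_eigenvector_exists:
  assumes F: "\<forall>i\<in>{1..m}. F i \<in> carrier_vec d"
    and w: "orthonormal_on d {1..d} w" and k: "k < d"
    and eig: "\<forall>i\<in>{1..k}. \<forall>z\<in>carrier_vec d. frame_form m F (w i) z = of_real (l i) * (w i \<bullet>c z)"
  shows "\<exists>x \<mu>. x \<in> carrier_vec d \<and> x \<bullet>c x = 1 \<and> (\<forall>i\<in>{1..k}. x \<bullet>c w i = 0) \<and>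
     (\<forall>z\<in>carrier_vec d. frame_form m F x z = complex_of_real \<mu> * (x \<bullet>c z))"
proof -
  have wc: "w i \<in> carrier_vec d" if "i \<in> {1..d}" for i using w that by (auto simp: orthonormal_on_def)
  have wo: "w i \<bullet>c w j = (if i = j then 1 else 0)" if "i \<in> {1..d}" "j \<in> {1..d}" for i j
    using w that by (auto simp: orthonormal_on_def)
  define C where "C = mat (d - k) (d - k) (\<lambda>(i,j). frame_form m F (w (j + Suc k)) (w (i + Suc k)))"
  have C: "C \<in> carrier_mat (d - k) (d - k)" by (simp add: C_def)
  obtain ev where "eigenvalue C ev"
    using spectrum_non_empty[OF C] k by (auto simp: spectrum_def)
  then obtain y where y: "y \<in> carrier_vec (d - k)" "y \<noteq> 0\<^sub>v (d - k)" "C *\<^sub>v y = ev \<cdot>\<^sub>v y"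
    using C by (auto simp: eigenvalue_def eigenvector_def)
  define x where "x = vec d (\<lambda>p. \<Sum>j\<in>{Suc k..d}. y $ (j - Suc k) * w j $ p)"
  have x: "x \<in> carrier_vec d" by (simp add: x_def)
  have xz: "x \<bullet>c z = (\<Sum>j\<in>{Suc k..d}. y $ (j - Suc k) * (w j \<bullet>c z))" if "z \<in> carrier_vec d" for z
    unfolding x_def using that by (rule cinner_lincomb) simp
  have xw: "x \<bullet>c w i = (if i \<le> k then 0 else y $ (i - Suc k))" if "i \<in> {1..d}" for i
  proof -
    have "x \<bullet>c w i = (\<Sum>j\<in>{Suc k..d}. y $ (j - Suc k) * (if j = i then 1 else 0))"
      unfolding xz[OF wc[OF that]] using that by (intro sum.cong refl) (auto simp: wo)
    then show ?thesis using that by (auto simp: if_distrib sum.delta' cong: if_cong)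
  qed
  \<comment> \<open>For \<open>i \<le> k\<close> both sides vanish as \<open>w i\<close> is an eigenvector orthogonal to \<open>x\<close>; for \<open>i > k\<close> this is a
    row of the eigenvalue equation for \<open>C\<close>.\<close>
  have Bw: "frame_form m F x (w i) = ev * (x \<bullet>c w i)" if i: "i \<in> {1..d}" for i
  proof (cases "i \<le> k")
    case True
    then have "frame_form m F (w i) x = of_real (l i) * (w i \<bullet>c x)" using eig i x by auto
    moreover have "w i \<bullet>c x = 0" using cinner_commute[OF x wc[OF i]] xw[OF i] True by simp
    ultimately show ?thesis
      using frame_form_commute[OF F wc[OF i] x] xw[OF i] True by simp
  next
    case False
    then have i': "i - Suc k < d - k" using i by auto
    have "ev * y $ (i - Suc k) = (C *\<^sub>v y) $ (i - Suc k)" using y i' by simp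
    also have "\<dots> = (\<Sum>j<d - k. y $ j * frame_form m F (w (j + Suc k)) (w i))"
      using i' y(1) False by (auto simp: C_def scalar_prod_def atLeast0LessThan mult.commute intro!: sum.cong)
    also have "\<dots> = (\<Sum>j\<in>{Suc k..d}. y $ (j - Suc k) * frame_form m F (w j) (w i))"
      by (rule sum.reindex_bij_witness[of _ "\<lambda>j. j - Suc k" "\<lambda>j. j + Suc k"]) (use k in auto)
    also have "\<dots> = frame_form m F x (w i)"
      unfolding x_def by (rule frame_form_lincomb[OF F, symmetric]) simp
    finally show ?thesis using xw[OF i] False by simp
  qed
  have B: "frame_form m F x z = ev * (x \<bullet>c z)" if z: "z \<in> carrier_vec d" for z
  proof -
    have "vec d (\<lambda>p. \<Sum>i\<in>{1..d}. (z \<bullet>c w i) * w i $ p) = z"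
      using vec_sum_orthonormal[OF w z] z by (intro eq_vecI) auto
    then have "frame_form m F z x = (\<Sum>i=1..d. (z \<bullet>c w i) * frame_form m F (w i) x)"
      using frame_form_lincomb[OF F, of "{1..d}" "\<lambda>i. z \<bullet>c w i" w x] by simp
    also have "\<dots> = (\<Sum>i=1..d. (z \<bullet>c w i) * (cnj ev * (w i \<bullet>c x)))"
      using frame_form_commute[OF F x wc] cinner_commute[OF x wc] Bw by (intro sum.cong refl) simp
    also have "\<dots> = cnj ev * (z \<bullet>c x)"
      unfolding parseval_cinner[OF w z x, symmetric] sum_distrib_left by (simp add: mult_ac)
    finally show ?thesis
      using frame_form_commute[OF F z x] cinner_commute[OF z x] by simp
  qed
  have x0: "(cvec_norm x)\<^sup>2 \<noteq> 0"
  proof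
    assume "(cvec_norm x)\<^sup>2 = 0"
    then have "x = 0\<^sub>v d" using vec_eq_0_if_cvec_norm_0 x by blast
    have "y $ i = 0" if "i < d - k" for i
    proof -
      have "i + Suc k \<in> {1..d}" using that by auto
      from xw[OF this] have "y $ i = x \<bullet>c w (i + Suc k)" by simp
      also have "\<dots> = 0" using \<open>x = 0\<^sub>v d\<close> wc[OF \<open>i + Suc k \<in> {1..d}\<close>] by (simp add: cinner_sum[where d = d])
      finally show ?thesis .
    qed
    then show False using y by (auto intro!: eq_vecI)
  qed
  \<comment> \<open>The Rayleigh quotient of \<open>x\<close>.\<close>
  define \<mu> where "\<mu> = frame_quad m F x / (cvec_norm x)\<^sup>2"
  have "complex_of_real (frame_quad m F x) = ev * of_real ((cvec_norm x)\<^sup>2)"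
    using B[OF x] frame_form_self[OF F x] cinner_self[of x] by simp
  then have ev: "ev = of_real \<mu>" using x0 by (simp add: \<mu>_def)
  define c where "c = complex_of_real (1 / cvec_norm x)"
  define u where "u = c \<cdot>\<^sub>v x"
  have u: "u \<in> carrier_vec d" using x by (simp add: u_def)
  have "(cvec_norm u)\<^sup>2 = 1"
    unfolding u_def cvec_norm_smult[OF x] c_def using x0 by (simp add: power_divide norm_divide)
  then have "u \<bullet>c u = 1" using cinner_self[of u] by simp
  moreover have "u \<bullet>c w i = 0" if "i \<in> {1..k}" for i
    using xw[of i] wc[of i] that k x by (simp add: u_def cinner_smult[where d = d])
  moreover have "frame_form m F u z = of_real \<mu> * (u \<bullet>c z)" if "z \<in> carrier_vec d" for z
  proof -
    have "frame_form m F u z = c * frame_form m F x z"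
      unfolding frame_form_def u_def sum_distrib_left
      using F x by (intro sum.cong refl) (simp add: cinner_smult[where d = d])
    then show ?thesis using B[OF that] x that ev by (simp add: u_def cinner_smult[where d = d])
  qed
  ultimately show ?thesis using u by blast
qed

lemma frame_form_eigenbasis_partial:
  assumes F: "\<forall>i\<in>{1..m}. F i \<in> carrier_vec d" and "k \<le> d"
  shows "\<exists>v l. orthonormal_on d {1..k} v \<and>
    (\<forall>i\<in>{1..k}. \<forall>z\<in>carrier_vec d. frame_form m F (v i) z = complex_of_real (l i) * (v i \<bullet>c z))"
  using assms(2)
proof (induction k)
  case 0
  show ?case by (simp add: orthonormal_on_def)
next
  case (Suc k)
  then obtain v l where v: "orthonormal_on d {1..k} v"
    "\<forall>i\<in>{1..k}. \<forall>z\<in>carrier_vec d. frame_form m F (v i) z = complex_of_real (l i) * (v i \<bullet>c z)" by auto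
  obtain w where w: "orthonormal_on d {1..d} w" "\<forall>i\<in>{1..k}. w i = v i"
    using orthonormal_extend[OF v(1)] Suc by auto
  obtain x \<mu> where x: "x \<in> carrier_vec d" "x \<bullet>c x = 1" "\<forall>i\<in>{1..k}. x \<bullet>c w i = 0"
    "\<forall>z\<in>carrier_vec d. frame_form m F x z = complex_of_real \<mu> * (x \<bullet>c z)"
    using frame_form_eigenvector_exists[OF F w(1), of k l] v w(2) Suc by auto
  have i: "insert (Suc k) {1..k} = {1..Suc k}" by auto
  have "orthonormal_on d (insert (Suc k) {1..k}) (v(Suc k := x))"
    using v x w by (intro orthonormal_on_insert) auto
  then have "orthonormal_on d {1..Suc k} (v(Suc k := x))" unfolding i .
  moreover have "\<forall>i\<in>{1..Suc k}. \<forall>z\<in>carrier_vec d. frame_form m F ((v(Suc k := x)) i) z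
      = complex_of_real ((l(Suc k := \<mu>)) i) * ((v(Suc k := x)) i \<bullet>c z)"
    using v(2) x(4) by (auto simp: le_Suc_eq)
  ultimately show ?case by blast
qed

lemma frame_op_index:
  assumes F: "\<forall>i\<in>{1..m}. F i \<in> carrier_vec d" and p: "p < d" and q: "q < d"
  shows "frame_op d m F $$ (p, q) = frame_form m F (unit_vec d q) (unit_vec d p)"
proof -
  have Fd: "dim_vec (F (Suc i)) = d" if "i < m" for i using F that by fastforce
  have "frame_op d m F $$ (p, q) = (\<Sum>i<m. F (Suc i) $ p * cnj (F (Suc i) $ q))"
    using p q Fd
    by (auto simp: frame_op_def synthesis_mat_def mat_adjoint_def scalar_prod_def atLeast0LessThan
        mat_of_cols_index mat_of_rows_index nth_upt simp del: upt_Suc intro!: sum.cong)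
  also have "\<dots> = (\<Sum>i=1..m. F i $ p * cnj (F i $ q))"
    by (rule sum.reindex_bij_witness[of _ "\<lambda>i. i - 1" Suc]) auto
  also have "\<dots> = frame_form m F (unit_vec d q) (unit_vec d p)"
    unfolding frame_form_def using F unit_vec_cinner[OF q] cinner_unit_vec[OF p] by (intro sum.cong refl) (simp add: mult.commute)
  finally show ?thesis .
qed

text \<open>The interface to the functional calculus: the columns of the diagonalizing unitary are the
eigenbasis \<open>v\<close>, and the potential is the sum of \<open>f\<close> over the eigenvalues \<open>l\<close>.\<close>

lemma frame_spectral:
  assumes F: "\<forall>i\<in>{1..m}. F i \<in> carrier_vec d"
  shows "\<exists>v l. orthonormal_on d {1..d} v \<and> (\<forall>k\<in>{1..d}. 0 \<le> l k) \<and>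
    (\<forall>x\<in>carrier_vec d. frame_quad m F x = (\<Sum>k=1..d. l k * (cmod (x \<bullet>c v k))\<^sup>2)) \<and>
    (\<forall>f. frame_potential d m f F = (\<Sum>k=1..d. f (l k)))"
proof -
  obtain v l where v: "orthonormal_on d {1..d} v"
    and B: "\<And>i z. i\<in>{1..d} \<Longrightarrow> z\<in>carrier_vec d \<Longrightarrow> frame_form m F (v i) z = complex_of_real (l i) * (v i \<bullet>c z)"
    using frame_form_eigenbasis_partial[OF F order.refl] by blast
  have vc: "v i \<in> carrier_vec d" if "i \<in> {1..d}" for i using v that by (auto simp: orthonormal_on_def)
  have Bxz: "frame_form m F x z = (\<Sum>k=1..d. of_real (l k) * ((x \<bullet>c v k) * (v k \<bullet>c z)))"
    if x: "x \<in> carrier_vec d" and z: "z \<in> carrier_vec d" for x z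
  proof -
    have "vec d (\<lambda>p. \<Sum>i\<in>{1..d}. (x \<bullet>c v i) * v i $ p) = x"
      using vec_sum_orthonormal[OF v x] x by (intro eq_vecI) auto
    then have "frame_form m F x z = (\<Sum>i=1..d. (x \<bullet>c v i) * frame_form m F (v i) z)"
      using frame_form_lincomb[OF F, of "{1..d}" "\<lambda>i. x \<bullet>c v i" v z] by simp
    then show ?thesis using B z by (simp add: mult_ac)
  qed
  have q: "frame_quad m F x = (\<Sum>k=1..d. l k * (cmod (x \<bullet>c v k))\<^sup>2)" if x: "x \<in> carrier_vec d" for x
  proof -
    have "complex_of_real (frame_quad m F x) = (\<Sum>k=1..d. of_real (l k) * ((x \<bullet>c v k) * (v k \<bullet>c x)))"
      using Bxz[OF x x] frame_form_self[OF F x] by simp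
    also have "\<dots> = of_real (\<Sum>k=1..d. l k * (cmod (x \<bullet>c v k))\<^sup>2)"
      unfolding of_real_sum of_real_mult
    proof (intro sum.cong refl)
      fix k assume "k \<in> {1..d}"
      from cinner_commute[OF x vc[OF this]]
      show "of_real (l k) * ((x \<bullet>c v k) * (v k \<bullet>c x)) = complex_of_real (l k) * of_real ((cmod (x \<bullet>c v k))\<^sup>2)"
        by (simp only: complex_norm_square)
    qed
    finally show ?thesis using of_real_eq_iff by blast
  qed
  have "l k = frame_quad m F (v k)" if "k \<in> {1..d}" for k
  proof -
    have "complex_of_real (frame_quad m F (v k)) = of_real (l k)"
      using B[OF that vc[OF that]] frame_form_self[OF F vc[OF that]] v that by (simp add: orthonormal_on_def)
    then show ?thesis by simp
  qed
  then have l0: "\<forall>k\<in>{1..d}. 0 \<le> l k" by (simp add: frame_quad_def sum_nonneg)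
  define U where "U = mat d d (\<lambda>(p,i). v (Suc i) $ p)"
  define V where "V = mat d d (\<lambda>(i,p). cnj (v (Suc i) $ p))"
  have c: "U \<in> carrier_mat d d" "V \<in> carrier_mat d d" by (auto simp: U_def V_def)
  have UV: "mat_adjoint U = V"
    by (rule eq_matI) (auto simp: U_def V_def mat_adjoint_def mat_of_rows_index)
  have "U * V = 1\<^sub>m d"
  proof (rule eq_matI)
    fix p q assume "p < dim_row (1\<^sub>m d)" "q < dim_col (1\<^sub>m d)"
    then have pq: "p < d" "q < d" by auto
    then have "(U * V) $$ (p, q) = (\<Sum>i<d. v (Suc i) $ p * cnj (v (Suc i) $ q))"
      by (simp add: U_def V_def scalar_prod_def atLeast0LessThan)
    also have "\<dots> = (\<Sum>i=1..d. v i $ p * cnj (v i $ q))"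
      by (rule sum.reindex_bij_witness[of _ "\<lambda>i. i - 1" Suc]) auto
    finally show "(U * V) $$ (p, q) = 1\<^sub>m d $$ (p, q)"
      using orthonormal_on_dual[OF v pq] pq by simp
  qed (auto simp: U_def V_def)
  then have U: "unitary_mat d U"
    unfolding unitary_mat_def UV using mat_mult_left_right_inverse[OF c] c by simp
  have "frame_op d m F = unitary_diag d U (\<lambda>i. l (Suc i))"
  proof (rule eq_matI)
    fix p q assume "p < dim_row (unitary_diag d U (\<lambda>i. l (Suc i)))" "q < dim_col (unitary_diag d U (\<lambda>i. l (Suc i)))"
    then have pq: "p < d" "q < d" using c by (auto simp: unitary_diag_def UV)
    have "unitary_diag d U (\<lambda>i. l (Suc i)) $$ (p, q)
        = (\<Sum>i<d. of_real (l (Suc i)) * (v (Suc i) $ p * cnj (v (Suc i) $ q)))"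
      unfolding unitary_diag_def UV mat_diag_mult_right[OF c(1)]
      using pq by (simp add: U_def V_def scalar_prod_def atLeast0LessThan mult_ac)
    also have "\<dots> = (\<Sum>i=1..d. of_real (l i) * (v i $ p * cnj (v i $ q)))"
      by (rule sum.reindex_bij_witness[of _ "\<lambda>i. i - 1" Suc]) auto
    also have "\<dots> = frame_form m F (unit_vec d q) (unit_vec d p)"
      using Bxz[of "unit_vec d q" "unit_vec d p"] cinner_unit_vec[OF pq(1)] unit_vec_cinner[OF pq(2)] vc
      by (simp add: mult_ac)
    finally show "frame_op d m F $$ (p, q) = unitary_diag d U (\<lambda>i. l (Suc i)) $$ (p, q)"
      using frame_op_index[OF F pq] by simp
  qed (use c in \<open>auto simp: unitary_diag_def UV frame_op_def synthesis_mat_def mat_adjoint_def\<close>)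
  then have "frame_potential d m f F = (\<Sum>k=1..d. f (l k))" for f
  proof -
    have "frame_potential d m f F = (\<Sum>i<d. f (l (Suc i)))"
      unfolding frame_potential_def 
      using mat_trace_hermitian_fun[OF U \<open>frame_op d m F = _\<close>, of f] by simp
    also have "\<dots> = (\<Sum>k=1..d. f (l k))"
      by (rule sum.reindex_bij_witness[of _ "\<lambda>i. i - 1" Suc]) auto
    finally show ?thesis .
  qed
  then show ?thesis using v l0 q by blast
qed

section \<open>Convex functions and doubly stochastic weights\<close>

text \<open>The supremum of the slopes of chords to the left of \<open>x\<close> is a subgradient, since slopes of chords
increase. At \<open>x = 0\<close> there are no such chords, and a convex function on the half line may indeed have
no subgradient there.\<close>

lemma convex_subgradient_exists:
  fixes f :: "real \<Rightarrow> real"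
  assumes f: "convex_on {0..} f" and x: "0 < x"
  shows "\<exists>s. \<forall>y\<ge>0. f x + s * (y - x) \<le> f y"
proof -
  define A where "A = (\<lambda>t. (f t - f x) / (t - x)) ` {0..<x}"
  have ne: "A \<noteq> {}" using x by (auto simp: A_def)
  have up: "a \<le> (f x - f y) / (x - y)" if "a \<in> A" "x < y" for a y
  proof -
    obtain t where t: "0 \<le> t" "t < x" "a = (f t - f x) / (t - x)" using \<open>a \<in> A\<close> by (auto simp: A_def)
    have "t \<in> {0..}" "y \<in> {0..}" using t that(2) by auto
    from convex_on_slope_le[OF f this t(2) that(2)] show ?thesis using t(3) by linarith
  qed
  have bdd: "bdd_above A"
    by (rule bdd_aboveI[of _ "(f x - f (x + 1)) / (x - (x + 1))"]) (rule up, auto)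
  have "f x + Sup A * (y - x) \<le> f y" if y: "0 \<le> y" for y
  proof (cases rule: linorder_cases[of y x])
    case less
    then have "(f y - f x) / (y - x) \<in> A" using y by (auto simp: A_def)
    then have "(f y - f x) / (y - x) \<le> Sup A" using bdd by (rule cSup_upper)
    then show ?thesis using less by (simp add: neg_divide_le_eq)
  next
    case greater
    have "Sup A \<le> (f x - f y) / (x - y)" using ne up greater by (intro cSup_least) auto
    then show ?thesis using greater by (simp add: neg_le_divide_eq algebra_simps)
  qed simp
  then show ?thesis by blast
qed

text \<open>If a support line met the graph a second time, strict convexity would push the midpoint of the two
contact points below the line.\<close>

lemma strictly_convex_above_subgradient:
  assumes f: "strictly_convex_on {0..} f" and s: "\<forall>z\<ge>0. f x + s * (z - x) \<le> f z"
    and xy: "0 \<le> x" "0 \<le> y" "y \<noteq> x"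
  shows "f x + s * (y - x) < f y"
proof -
  have "f (1/2 * x + 1/2 * y) < 1/2 * f x + 1/2 * f y"
    using f[unfolded strictly_convex_on_def, THEN conjunct2, rule_format, of x y "1/2" "1/2"] xy by simp
  moreover have "f x + s * ((1/2 * x + 1/2 * y) - x) \<le> f (1/2 * x + 1/2 * y)"
    by (rule s[rule_format]) (use xy in simp)
  moreover have "s * ((1/2 * x + 1/2 * y) - x) = 1/2 * (s * (y - x))" by (simp add: field_simps)
  ultimately show ?thesis by linarith
qed

text \<open>Summation by parts; the induction shows that the weighted sum up to \<open>j\<close> is at least \<open>t j\<close> times the
plain sum.\<close>

lemma weighted_sum_nonneg_of_partial_sums:
  fixes t x :: "nat \<Rightarrow> real"
  assumes "\<forall>i\<in>{1..r}. 0 \<le> t i" "antimono_on {1..r} t" "\<forall>j\<in>{1..r}. 0 \<le> (\<Sum>i=1..j. x i)"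
  shows "0 \<le> (\<Sum>i=1..r. t i * x i)"
proof -
  have "1 \<le> j \<Longrightarrow> j \<le> r \<Longrightarrow> t j * (\<Sum>i=1..j. x i) \<le> (\<Sum>i=1..j. t i * x i)" for j
  proof (induction j)
    case (Suc j)
    show ?case
    proof (cases "j = 0")
      case False
      then have j: "j \<in> {1..r}" "Suc j \<in> {1..r}" using Suc.prems by auto
      have "t (Suc j) \<le> t j" using assms(2) j unfolding monotone_on_def by auto
      then have "t (Suc j) * (\<Sum>i=1..j. x i) \<le> t j * (\<Sum>i=1..j. x i)"
        using assms(3) j by (intro mult_right_mono) auto
      also have "\<dots> \<le> (\<Sum>i=1..j. t i * x i)" using Suc.IH j by auto
      finally show ?thesis by (simp add: algebra_simps)
    qed simp
  qed simp
  moreover have "0 \<le> t r * (\<Sum>i=1..r. x i)" if "1 \<le> r"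
    using assms(1,3) that by (intro mult_nonneg_nonneg) auto
  ultimately have "1 \<le> r \<Longrightarrow> ?thesis" by (meson order.refl order.trans)
  then show ?thesis by (cases "r = 0") simp_all
qed

text \<open>This is the analytic core. In the application \<open>p i k\<close> is the squared overlap of two orthonormal bases,
\<open>l\<close> are eigenvalues and \<open>\<delta> i\<close> are the diagonal entries of the operator in the other basis. Averaging
the tangent inequalities \<open>f (l k) \<ge> f (\<mu> i) + g (\<mu> i) * (l k - \<mu> i)\<close> with the weights \<open>p i k\<close> gives
\<open>(\<Sum>k. f (l k)) \<ge> (\<Sum>i. f (\<mu> i)) + (\<Sum>i. g (\<mu> i) * (\<delta> i - \<mu> i))\<close>, and the last sum is nonnegative by
summation by parts, since \<open>g\<close> is increasing and \<open>\<mu>\<close> decreasing. Thus neither the \<open>l k\<close> nor the \<open>\<delta> i\<close>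
have to be sorted. Only the first \<open>r\<close> partial sums matter because \<open>\<mu>\<close> is constant beyond \<open>r\<close>. If
equality holds and \<open>f\<close> is strictly convex, each averaged tangent inequality with positive weight must
be an equality, which forces \<open>l k = \<mu> i\<close>.\<close>

lemma doubly_stochastic_convex_bound:
  fixes p :: "nat \<Rightarrow> nat \<Rightarrow> real"
  assumes f: "convex_on {0..} f"
    and p: "\<And>i k. i \<in> {1..d} \<Longrightarrow> k \<in> {1..d} \<Longrightarrow> 0 \<le> p i k"
    and row: "\<And>i. i \<in> {1..d} \<Longrightarrow> (\<Sum>k=1..d. p i k) = 1"
    and col: "\<And>k. k \<in> {1..d} \<Longrightarrow> (\<Sum>i=1..d. p i k) = 1"
    and l: "\<And>k. k \<in> {1..d} \<Longrightarrow> 0 \<le> l k"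
    and \<mu>: "\<And>i. i \<in> {1..d} \<Longrightarrow> 0 < \<mu> i" "antimono_on {1..d} \<mu>"
    and r: "r < d" "\<And>i. i \<in> {r+1..d} \<Longrightarrow> \<mu> i = \<mu> d"
    and part: "\<And>j. j \<in> {1..r} \<Longrightarrow> (\<Sum>i=1..j. \<mu> i) \<le> (\<Sum>i=1..j. \<Sum>k=1..d. p i k * l k)"
    and total: "(\<Sum>i=1..d. \<mu> i) = (\<Sum>k=1..d. l k)"
  shows "(\<Sum>i=1..d. f (\<mu> i)) \<le> (\<Sum>k=1..d. f (l k))"
    and "strictly_convex_on {0..} f \<Longrightarrow> (\<Sum>k=1..d. f (l k)) \<le> (\<Sum>i=1..d. f (\<mu> i)) \<Longrightarrow>
      i \<in> {1..d} \<Longrightarrow> k \<in> {1..d} \<Longrightarrow> p i k \<noteq> 0 \<Longrightarrow> l k = \<mu> i"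
proof -
  obtain g where g: "\<And>x y. 0 < x \<Longrightarrow> 0 \<le> y \<Longrightarrow> f x + g x * (y - x) \<le> f y"
    using convex_subgradient_exists[OF f] by metis
  have g_mono: "g x \<le> g y" if "0 < x" "x \<le> y" for x y
  proof (cases "x = y")
    case False
    have "f x + g x * (y - x) \<le> f y" "f y + g y * (x - y) \<le> f x" using g that by auto
    then have "g x * (y - x) \<le> g y * (y - x)" by (simp add: algebra_simps)
    then show ?thesis using that False by simp
  qed simp
  define \<delta> where "\<delta> i = (\<Sum>k=1..d. p i k * l k)" for i
  \<comment> \<open>The weighted gaps of the tangent inequalities.\<close>
  define D where "D i k = p i k * (f (l k) - (f (\<mu> i) + g (\<mu> i) * (l k - \<mu> i)))" for i k
  have D0: "0 \<le> D i k" if "i \<in> {1..d}" "k \<in> {1..d}" for i k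
    unfolding D_def using p[OF that] g[OF \<mu>(1)[OF that(1)] l[OF that(2)]] by simp
  have sum_l: "(\<Sum>i=1..d. \<Sum>k=1..d. p i k * h k) = (\<Sum>k=1..d. h k)" for h :: "nat \<Rightarrow> real"
  proof -
    have "(\<Sum>i=1..d. \<Sum>k=1..d. p i k * h k) = (\<Sum>k=1..d. (\<Sum>i=1..d. p i k) * h k)"
      by (subst sum.swap) (simp add: sum_distrib_right)
    then show ?thesis using col by simp
  qed
  have Di: "(\<Sum>k=1..d. D i k) = (\<Sum>k=1..d. p i k * f (l k)) - f (\<mu> i) - g (\<mu> i) * (\<delta> i - \<mu> i)"
    if "i \<in> {1..d}" for i
  proof -
    have "(\<Sum>k=1..d. D i k) = (\<Sum>k=1..d. p i k * f (l k) - p i k * (f (\<mu> i) - g (\<mu> i) * \<mu> i)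
        - g (\<mu> i) * (p i k * l k))"
      by (intro sum.cong refl) (simp add: D_def algebra_simps)
    also have "\<dots> = (\<Sum>k=1..d. p i k * f (l k)) - (\<Sum>k=1..d. p i k) * (f (\<mu> i) - g (\<mu> i) * \<mu> i)
        - g (\<mu> i) * \<delta> i"
      by (simp add: sum_subtractf sum_distrib_left sum_distrib_right \<delta>_def)
    finally show ?thesis using row[OF that] by (simp add: algebra_simps)
  qed
  have D: "(\<Sum>i=1..d. \<Sum>k=1..d. D i k) = (\<Sum>k=1..d. f (l k)) - (\<Sum>i=1..d. f (\<mu> i))
      - (\<Sum>i=1..d. g (\<mu> i) * (\<delta> i - \<mu> i))"
  proof -
    have "(\<Sum>i=1..d. \<Sum>k=1..d. D i k) =
        (\<Sum>i=1..d. (\<Sum>k=1..d. p i k * f (l k)) - f (\<mu> i) - g (\<mu> i) * (\<delta> i - \<mu> i))"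
      by (intro sum.cong refl Di)
    then show ?thesis using sum_l[of "\<lambda>k. f (l k)"] by (simp only: sum_subtractf)
  qed
  have "(\<Sum>i=1..d. \<delta> i - \<mu> i) = 0" using sum_l[of l] total by (simp add: \<delta>_def sum_subtractf)
  \<comment> \<open>As the totals agree, \<open>g (\<mu> d)\<close> may be subtracted from all slopes; this makes them
    nonnegative and cancels the terms beyond \<open>r\<close>.\<close>
  then have "(\<Sum>i=1..d. g (\<mu> d) * (\<delta> i - \<mu> i)) = 0"
    unfolding sum_distrib_left[symmetric] by (simp only: mult_zero_right)
  then have "(\<Sum>i=1..d. g (\<mu> i) * (\<delta> i - \<mu> i)) = (\<Sum>i=1..d. (g (\<mu> i) - g (\<mu> d)) * (\<delta> i - \<mu> i))"
    unfolding left_diff_distrib sum_subtractf by linarith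
  also have "\<dots> = (\<Sum>i=1..r. (g (\<mu> i) - g (\<mu> d)) * (\<delta> i - \<mu> i))"
  proof (rule sum.mono_neutral_right)
    show "\<forall>i\<in>{1..d} - {1..r}. (g (\<mu> i) - g (\<mu> d)) * (\<delta> i - \<mu> i) = 0"
    proof
      fix i assume "i \<in> {1..d} - {1..r}"
      then have "i \<in> {r+1..d}" by auto
      then have "\<mu> i = \<mu> d" by (rule r(2))
      then show "(g (\<mu> i) - g (\<mu> d)) * (\<delta> i - \<mu> i) = 0" by simp
    qed
  qed (use r(1) in auto)
  also have "\<dots> \<ge> 0"
  proof (rule weighted_sum_nonneg_of_partial_sums)
    have "\<mu> j \<le> \<mu> i" if "1 \<le> i" "i \<le> j" "j \<le> d" for i j
      using \<mu>(2) that unfolding monotone_on_def by auto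
    then show "\<forall>i\<in>{1..r}. 0 \<le> g (\<mu> i) - g (\<mu> d)" "antimono_on {1..r} (\<lambda>i. g (\<mu> i) - g (\<mu> d))"
      using r(1) \<mu>(1) by (auto intro!: g_mono monotone_onI)
    show "\<forall>j\<in>{1..r}. 0 \<le> (\<Sum>i=1..j. \<delta> i - \<mu> i)" using part by (auto simp: \<delta>_def sum_subtractf)
  qed
  finally have E: "0 \<le> (\<Sum>i=1..d. g (\<mu> i) * (\<delta> i - \<mu> i))" .
  have "0 \<le> (\<Sum>i=1..d. \<Sum>k=1..d. D i k)" using D0 by (intro sum_nonneg) auto
  with D E show "(\<Sum>i=1..d. f (\<mu> i)) \<le> (\<Sum>k=1..d. f (l k))" by linarith
  assume strict: "strictly_convex_on {0..} f" and le: "(\<Sum>k=1..d. f (l k)) \<le> (\<Sum>i=1..d. f (\<mu> i))"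
    and ik: "i \<in> {1..d}" "k \<in> {1..d}" "p i k \<noteq> 0"
  have "(\<Sum>i=1..d. \<Sum>k=1..d. D i k) = 0"
    using D E le \<open>0 \<le> (\<Sum>i=1..d. \<Sum>k=1..d. D i k)\<close> by linarith
  then have "(\<Sum>k=1..d. D i k) = 0"
    using ik D0 by (subst (asm) sum_nonneg_eq_0_iff) (auto intro!: sum_nonneg)
  then have "D i k = 0" using ik D0 by (subst (asm) sum_nonneg_eq_0_iff) auto
  then have "f (\<mu> i) + g (\<mu> i) * (l k - \<mu> i) = f (l k)" using ik(3) by (simp add: D_def)
  moreover have "\<forall>z\<ge>0. f (\<mu> i) + g (\<mu> i) * (z - \<mu> i) \<le> f z" using g \<mu>(1)[OF ik(1)] by auto
  ultimately show "l k = \<mu> i"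
    using strictly_convex_above_subgradient[OF strict, of "\<mu> i" "g (\<mu> i)" "l k"] \<mu>(1)[OF ik(1)] l[OF ik(2)]
    by force
qed

section \<open>Bounds for the frame potential\<close>

lemma frame_trace:
  assumes F: "\<forall>i\<in>{1..m}. F i \<in> carrier_vec d" and u: "orthonormal_on d {1..d} u"
  shows "(\<Sum>i=1..d. frame_quad m F (u i)) = (\<Sum>k=1..m. (cvec_norm (F k))\<^sup>2)"
proof -
  have "(\<Sum>i=1..d. frame_quad m F (u i)) = (\<Sum>k=1..m. \<Sum>i=1..d. (cmod (u i \<bullet>c F k))\<^sup>2)"
    unfolding frame_quad_def by (rule sum.swap)
  also have "\<dots> = (\<Sum>k=1..m. (cvec_norm (F k))\<^sup>2)"
  proof (rule sum.cong[OF refl])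
    fix k assume "k \<in> {1..m}"
    then have Fk: "F k \<in> carrier_vec d" using F by auto
    have "(\<Sum>i=1..d. (cmod (u i \<bullet>c F k))\<^sup>2) = (\<Sum>i=1..d. (cmod (F k \<bullet>c u i))\<^sup>2)"
      using u by (intro sum.cong refl) (auto simp: orthonormal_on_def cmod_cinner_commute[OF Fk])
    then show "(\<Sum>i=1..d. (cmod (u i \<bullet>c F k))\<^sup>2) = (cvec_norm (F k))\<^sup>2"
      using parseval_norm[OF u Fk] by simp
  qed
  finally show ?thesis .
qed

lemma orthonormal_overlap_sums:
  assumes u: "orthonormal_on d {1..d} u" and v: "orthonormal_on d {1..d} v" and i: "i \<in> {1..d}"
  shows "(\<Sum>k=1..d. (cmod (u i \<bullet>c v k))\<^sup>2) = 1" "(\<Sum>k=1..d. (cmod (u k \<bullet>c v i))\<^sup>2) = 1"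
proof -
  have c: "u i \<in> carrier_vec d" "v i \<in> carrier_vec d" "u i \<bullet>c u i = 1" "v i \<bullet>c v i = 1"
    using u v i by (auto simp: orthonormal_on_def)
  show "(\<Sum>k=1..d. (cmod (u i \<bullet>c v k))\<^sup>2) = 1" using parseval_norm[OF v c(1)] cvec_norm_sq_eq_1[OF c(3)] by simp
  have "(\<Sum>k=1..d. (cmod (u k \<bullet>c v i))\<^sup>2) = (\<Sum>k=1..d. (cmod (v i \<bullet>c u k))\<^sup>2)"
    using u by (intro sum.cong refl) (auto simp: orthonormal_on_def cmod_cinner_commute[OF c(2)])
  then show "(\<Sum>k=1..d. (cmod (u k \<bullet>c v i))\<^sup>2) = 1" using parseval_norm[OF u c(2)] cvec_norm_sq_eq_1[OF c(4)] by simp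
qed

text \<open>The orthonormal basis \<open>u\<close> may be chosen freely, so the partial sum condition is on the diagonal of
the frame operator in a convenient basis. The equality statement says that in the strictly convex
case \<open>u\<close> diagonalizes the frame operator with eigenvalues \<open>\<mu>\<close>, expressed through its quadratic form
on each eigenspace: whenever \<open>x\<close> has overlap with an eigenvector \<open>v k\<close>, some \<open>u i\<close> overlaps both
\<open>x\<close> and \<open>v k\<close>, and then \<open>l k = \<mu> i = b\<close>.\<close>

lemma frame_potential_lower_bound:
  assumes f: "convex_on {0..} f"
    and F: "\<forall>i\<in>{1..m}. F i \<in> carrier_vec d" and u: "orthonormal_on d {1..d} u"
    and \<mu>: "\<And>i. i \<in> {1..d} \<Longrightarrow> 0 < \<mu> i" "antimono_on {1..d} \<mu>"
    and r: "r < d" "\<And>i. i \<in> {r+1..d} \<Longrightarrow> \<mu> i = \<mu> d"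
    and part: "\<And>j. j \<in> {1..r} \<Longrightarrow> (\<Sum>i=1..j. \<mu> i) \<le> (\<Sum>i=1..j. frame_quad m F (u i))"
    and total: "(\<Sum>i=1..d. \<mu> i) = (\<Sum>k=1..m. (cvec_norm (F k))\<^sup>2)"
  shows "(\<Sum>i=1..d. f (\<mu> i)) \<le> frame_potential d m f F"
    and "strictly_convex_on {0..} f \<Longrightarrow> frame_potential d m f F \<le> (\<Sum>i=1..d. f (\<mu> i)) \<Longrightarrow>
      x \<in> carrier_vec d \<Longrightarrow> (\<And>i. i \<in> {1..d} \<Longrightarrow> x \<bullet>c u i \<noteq> 0 \<Longrightarrow> \<mu> i = b) \<Longrightarrow>
      frame_quad m F x = b * (cvec_norm x)\<^sup>2"
proof -
  obtain v l where v: "orthonormal_on d {1..d} v" and l0: "\<And>k. k\<in>{1..d} \<Longrightarrow> 0 \<le> l k"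
    and q: "\<And>x. x\<in>carrier_vec d \<Longrightarrow> frame_quad m F x = (\<Sum>k=1..d. l k * (cmod (x \<bullet>c v k))\<^sup>2)"
    and P: "\<And>f. frame_potential d m f F = (\<Sum>k=1..d. f (l k))"
    using frame_spectral[OF F] by blast
  define p where "p i k = (cmod (u i \<bullet>c v k))\<^sup>2" for i k
  have uc: "u i \<in> carrier_vec d" if "i \<in> {1..d}" for i using u that by (auto simp: orthonormal_on_def)
  have p0: "\<And>i k. i \<in> {1..d} \<Longrightarrow> k \<in> {1..d} \<Longrightarrow> 0 \<le> p i k" by (simp add: p_def)
  have row: "\<And>i. i \<in> {1..d} \<Longrightarrow> (\<Sum>k=1..d. p i k) = 1"
    and col: "\<And>k. k \<in> {1..d} \<Longrightarrow> (\<Sum>i=1..d. p i k) = 1"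
    unfolding p_def by (rule orthonormal_overlap_sums[OF u v], assumption)+
  have qu: "frame_quad m F (u i) = (\<Sum>k=1..d. p i k * l k)" if "i \<in> {1..d}" for i
    using q[OF uc[OF that]] by (simp add: p_def mult.commute)
  have part': "(\<Sum>i=1..j. \<mu> i) \<le> (\<Sum>i=1..j. \<Sum>k=1..d. p i k * l k)" if "j \<in> {1..r}" for j
  proof -
    have "(\<Sum>i=1..j. frame_quad m F (u i)) = (\<Sum>i=1..j. \<Sum>k=1..d. p i k * l k)"
      using that r(1) by (intro sum.cong refl qu) auto
    then show ?thesis using part[OF that] by simp
  qed
  have "(\<Sum>k=1..m. (cvec_norm (F k))\<^sup>2) = (\<Sum>i=1..d. \<Sum>k=1..d. p i k * l k)"
    unfolding frame_trace[OF F u, symmetric] by (intro sum.cong refl qu)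
  also have "\<dots> = (\<Sum>k=1..d. (\<Sum>i=1..d. p i k) * l k)"
    by (subst sum.swap) (simp add: sum_distrib_right)
  also have "\<dots> = (\<Sum>k=1..d. l k)" by (intro sum.cong refl) (simp only: col mult_1)
  finally have total': "(\<Sum>i=1..d. \<mu> i) = (\<Sum>k=1..d. l k)" using total by simp
  note bound = doubly_stochastic_convex_bound[OF f p0 row col l0 \<mu> r part' total']
  show "(\<Sum>i=1..d. f (\<mu> i)) \<le> frame_potential d m f F" unfolding P by (rule bound(1))
  assume strict: "strictly_convex_on {0..} f" and le: "frame_potential d m f F \<le> (\<Sum>i=1..d. f (\<mu> i))"
    and x: "x \<in> carrier_vec d" and xb: "\<And>i. i \<in> {1..d} \<Longrightarrow> x \<bullet>c u i \<noteq> 0 \<Longrightarrow> \<mu> i = b"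
  have "l k * (cmod (x \<bullet>c v k))\<^sup>2 = b * (cmod (x \<bullet>c v k))\<^sup>2" if k: "k \<in> {1..d}" for k
  proof (cases "x \<bullet>c v k = 0")
    case False
    have "v k \<in> carrier_vec d" using v k by (auto simp: orthonormal_on_def)
    from parseval_cinner[OF u x this] False
    obtain i where i: "i \<in> {1..d}" "(x \<bullet>c u i) * (u i \<bullet>c v k) \<noteq> 0"
      by (metis (no_types, lifting) sum.neutral)
    have "l k = \<mu> i"
      by (rule bound(2)) (use strict le i k in \<open>auto simp: P p_def\<close>)
    then show ?thesis using xb[OF i(1)] i(2) by simp
  qed simp
  then have "frame_quad m F x = b * (\<Sum>k=1..d. (cmod (x \<bullet>c v k))\<^sup>2)"
    unfolding q[OF x] sum_distrib_left by (intro sum.cong refl) 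
  then show "frame_quad m F x = b * (cvec_norm x)\<^sup>2" using parseval_norm[OF v x] by simp
qed

text \<open>Here \<open>\<mu>\<close> are in fact the eigenvalues and equality holds, but Jensen's inequality, applied to
\<open>l k = (\<Sum>i. \<mu> i * (cmod (v k \<bullet>c e i))\<^sup>2)\<close>, avoids comparing the two diagonalizations.\<close>

lemma frame_potential_upper_bound:
  assumes f: "convex_on {0..} f" and d: "0 < d"
    and F: "\<forall>i\<in>{1..m}. F i \<in> carrier_vec d" and e: "orthonormal_on d {1..d} e"
    and \<mu>: "\<And>i. i \<in> {1..d} \<Longrightarrow> 0 \<le> \<mu> i"
    and quad: "\<And>x. x \<in> carrier_vec d \<Longrightarrow> frame_quad m F x = (\<Sum>i=1..d. \<mu> i * (cmod (x \<bullet>c e i))\<^sup>2)"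
  shows "frame_potential d m f F \<le> (\<Sum>i=1..d. f (\<mu> i))"
proof -
  obtain v l where v: "orthonormal_on d {1..d} v" and l0: "\<And>k. k\<in>{1..d} \<Longrightarrow> 0 \<le> l k"
    and q: "\<And>x. x\<in>carrier_vec d \<Longrightarrow> frame_quad m F x = (\<Sum>k=1..d. l k * (cmod (x \<bullet>c v k))\<^sup>2)"
    and P: "\<And>f. frame_potential d m f F = (\<Sum>k=1..d. f (l k))"
    using frame_spectral[OF F] by blast
  define p where "p k i = (cmod (v k \<bullet>c e i))\<^sup>2" for k i
  have "f (l k) \<le> (\<Sum>i=1..d. p k i * f (\<mu> i))" if k: "k \<in> {1..d}" for k
  proof -
    have vk: "v k \<in> carrier_vec d" using v k by (auto simp: orthonormal_on_def)
    have "frame_quad m F (v k) = (\<Sum>j=1..d. l j * (if j = k then 1 else 0))"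
      unfolding q[OF vk] using v k by (intro sum.cong refl) (auto simp: orthonormal_on_def)
    also have "\<dots> = l k" using k by (simp add: if_distrib cong: if_cong)
    finally have "l k = (\<Sum>i=1..d. p k i *\<^sub>R \<mu> i)"
      unfolding quad[OF vk] by (simp add: p_def mult.commute)
    then show ?thesis
      using convex_on_sum[OF _ _ f, of "{1..d}" "p k" \<mu>] d \<mu> orthonormal_overlap_sums(1)[OF v e k]
      by (simp add: p_def)
  qed
  then have "(\<Sum>k=1..d. f (l k)) \<le> (\<Sum>k=1..d. \<Sum>i=1..d. p k i * f (\<mu> i))" by (intro sum_mono)
  also have "\<dots> = (\<Sum>i=1..d. (\<Sum>k=1..d. p k i) * f (\<mu> i))"
    by (subst sum.swap) (simp add: sum_distrib_right)
  also have "\<dots> = (\<Sum>i=1..d. f (\<mu> i))"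
    unfolding p_def by (intro sum.cong refl) (simp only: orthonormal_overlap_sums(2)[OF v e] mult_1)
  finally show ?thesis unfolding P .
qed

text \<open>For linearly independent vectors this is the Gram-Schmidt basis: the condition says that \<open>G j\<close> has no
component along \<open>u i\<close> for \<open>i > j\<close>. Choosing \<open>u d, u (d-1), \<dots>\<close> in descending order, each has to satisfy
only \<open>d - 1\<close> orthogonality conditions, and dependent vectors need no special treatment.\<close>

lemma flag_basis_exists:
  assumes G: "\<And>j. j \<in> {1..<d} \<Longrightarrow> G j \<in> carrier_vec d"
  shows "\<exists>u. orthonormal_on d {1..d} u \<and> (\<forall>i\<in>{1..d}. \<forall>j\<in>{1..<i}. G j \<bullet>c u i = 0)"
proof -
  have "k \<le> d \<Longrightarrow> \<exists>u. orthonormal_on d {d-k+1..d} u \<and> (\<forall>i\<in>{d-k+1..d}. \<forall>j\<in>{1..<i}. G j \<bullet>c u i = 0)" for k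
  proof (induction k)
    case 0
    show ?case by (simp add: orthonormal_on_def)
  next
    case (Suc k)
    then obtain u where u: "orthonormal_on d {d-k+1..d} u" "\<forall>i\<in>{d-k+1..d}. \<forall>j\<in>{1..<i}. G j \<bullet>c u i = 0"
      by auto
    define A where "A = G ` {1..<d-k} \<union> u ` {d-k+1..d}"
    have "card A \<le> card (G ` {1..<d-k}) + card (u ` {d-k+1..d})" unfolding A_def by (rule card_Un_le)
    also have "\<dots> \<le> card {1..<d-k} + card {d-k+1..d}" by (intro add_mono card_image_le) auto
    also have "\<dots> < d" using Suc.prems by simp
    finally have "card A < d" .
    moreover have "A \<subseteq> carrier_vec d" unfolding A_def using G u(1) by (auto simp: orthonormal_on_def)
    moreover have "finite A" by (simp add: A_def)
    ultimately obtain x where x: "x \<in> carrier_vec d" "x \<bullet>c x = 1" "\<forall>y\<in>A. y \<bullet>c x = 0 \<and> x \<bullet>c y = 0"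
      using unit_vec_orthogonal_exists by blast
    have i: "insert (d - k) {d-k+1..d} = {d - Suc k + 1..d}" using Suc.prems by auto
    have "orthonormal_on d (insert (d - k) {d-k+1..d}) (u(d - k := x))"
      using u x by (intro orthonormal_on_insert) (auto simp: A_def)
    moreover have "\<forall>i\<in>insert (d - k) {d-k+1..d}. \<forall>j\<in>{1..<i}. G j \<bullet>c (u(d - k := x)) i = 0"
      using u x by (auto simp: A_def)
    ultimately show ?case unfolding i by blast
  qed
  from this[of d] show ?thesis by simp
qed

text \<open>The first \<open>j\<close> frame vectors lie in the span of \<open>u 1, \<dots>, u j\<close>, so they contribute their full norms to
the first \<open>j\<close> diagonal entries; the remaining vectors contribute the nonnegative last term.\<close>

lemma flag_basis_partial_sums:
  assumes F: "\<forall>i\<in>{1..m}. F i \<in> carrier_vec d" and u: "orthonormal_on d {1..d} u"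
    and flag: "\<forall>i\<in>{1..d}. \<forall>j\<in>{1..<i}. F j \<bullet>c u i = 0" and j: "j \<le> d" "d \<le> m"
  shows "(\<Sum>i=1..j. frame_quad m F (u i)) =
    (\<Sum>k=1..j. (cvec_norm (F k))\<^sup>2) + (\<Sum>k=j+1..m. \<Sum>i=1..j. (cmod (F k \<bullet>c u i))\<^sup>2)"
proof -
  have uc: "u i \<in> carrier_vec d" if "i \<in> {1..d}" for i using u that by (auto simp: orthonormal_on_def)
  have "(\<Sum>i=1..j. frame_quad m F (u i)) = (\<Sum>k=1..m. \<Sum>i=1..j. (cmod (u i \<bullet>c F k))\<^sup>2)"
    unfolding frame_quad_def by (rule sum.swap)
  also have "\<dots> = (\<Sum>k=1..m. \<Sum>i=1..j. (cmod (F k \<bullet>c u i))\<^sup>2)"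
    using F j by (intro sum.cong refl arg_cong[where f = "\<lambda>x. x\<^sup>2"] cmod_cinner_commute) (auto intro!: uc)
  also have "\<dots> = (\<Sum>k=1..j. \<Sum>i=1..j. (cmod (F k \<bullet>c u i))\<^sup>2) + (\<Sum>k=j+1..m. \<Sum>i=1..j. (cmod (F k \<bullet>c u i))\<^sup>2)"
    using sum.ub_add_nat[of 1 j _ "m - j"] j by simp
  also have "(\<Sum>k=1..j. \<Sum>i=1..j. (cmod (F k \<bullet>c u i))\<^sup>2) = (\<Sum>k=1..j. (cvec_norm (F k))\<^sup>2)"
  proof (rule sum.cong[OF refl])
    fix k assume k: "k \<in> {1..j}"
    then have "F k \<in> carrier_vec d" using F j by auto
    from parseval_norm[OF u this]
    have "(cvec_norm (F k))\<^sup>2 = (\<Sum>i=1..d. (cmod (F k \<bullet>c u i))\<^sup>2)" by simp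
    also have "\<dots> = (\<Sum>i=1..j. (cmod (F k \<bullet>c u i))\<^sup>2)"
      using flag k j by (intro sum.mono_neutral_right) auto
    finally show "(\<Sum>i=1..j. (cmod (F k \<bullet>c u i))\<^sup>2) = (cvec_norm (F k))\<^sup>2" by simp
  qed
  finally show ?thesis .
qed

section \<open>Frames with prescribed norms\<close>

text \<open>A real rotation of the pair \<open>(F i, F j)\<close> leaves the frame operator unchanged. A quarter turn moves
the norm of \<open>F i\<close> to that of \<open>F j\<close>, so by the intermediate value theorem all norms in between occur.\<close>

lemma frame_rotate:
  assumes F: "\<forall>k\<in>{1..m}. F k \<in> carrier_vec d" and ij: "i \<in> {1..m}" "j \<in> {1..m}" "i \<noteq> j"
    and t: "(cvec_norm (F j))\<^sup>2 \<le> t" "t \<le> (cvec_norm (F i))\<^sup>2"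
  shows "\<exists>G. (\<forall>k\<in>{1..m}. G k \<in> carrier_vec d) \<and> (\<forall>k. k \<noteq> i \<longrightarrow> k \<noteq> j \<longrightarrow> G k = F k) \<and>
    (\<forall>x\<in>carrier_vec d. frame_quad m G x = frame_quad m F x) \<and>
    (cvec_norm (G i))\<^sup>2 = t \<and> (cvec_norm (G j))\<^sup>2 = (cvec_norm (F i))\<^sup>2 + (cvec_norm (F j))\<^sup>2 - t"
proof -
  define mix where "mix c s = vec d (\<lambda>p. complex_of_real c * F i $ p + complex_of_real s * F j $ p)" for c s
  have mix: "mix c s \<in> carrier_vec d" for c s by (simp add: mix_def)
  have Fij: "F i \<in> carrier_vec d" "F j \<in> carrier_vec d" using F ij by auto
  have rot: "(cmod (complex_of_real c * z + complex_of_real s * w))\<^sup>2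
      + (cmod (complex_of_real (- s) * z + complex_of_real c * w))\<^sup>2 = (cmod z)\<^sup>2 + (cmod w)\<^sup>2"
    if "c\<^sup>2 + s\<^sup>2 = 1" for c s :: real and z w
  proof -
    have "(cmod (complex_of_real c * z + complex_of_real s * w))\<^sup>2
      + (cmod (complex_of_real (- s) * z + complex_of_real c * w))\<^sup>2 = (c\<^sup>2 + s\<^sup>2) * ((cmod z)\<^sup>2 + (cmod w)\<^sup>2)"
      unfolding cmod_power2 by (simp add: power2_eq_square algebra_simps)
    then show ?thesis using that by simp
  qed
  define N where "N \<theta> = (cvec_norm (mix (cos \<theta>) (sin \<theta>)))\<^sup>2" for \<theta>
  have N: "N \<theta> = (\<Sum>p<d. (cmod (complex_of_real (cos \<theta>) * F i $ p + complex_of_real (sin \<theta>) * F j $ p))\<^sup>2)" for \<theta>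
    unfolding N_def cvec_norm_sq[OF mix] by (simp add: mix_def)
  have "N 0 = (cvec_norm (F i))\<^sup>2" "N (pi/2) = (cvec_norm (F j))\<^sup>2"
    unfolding N cvec_norm_sq[OF Fij(1)] cvec_norm_sq[OF Fij(2)] by simp_all
  moreover have "continuous_on {0..pi/2} N" unfolding N by (intro continuous_intros)
  ultimately obtain \<theta> where \<theta>: "N \<theta> = t" using IVT2'[of N "pi/2" t 0] t by auto
  define G where "G = F(i := mix (cos \<theta>) (sin \<theta>), j := mix (- sin \<theta>) (cos \<theta>))"
  have Gi: "G i = mix (cos \<theta>) (sin \<theta>)" and Gj: "G j = mix (- sin \<theta>) (cos \<theta>)" using ij by (simp_all add: G_def)
  have cs: "(cos \<theta>)\<^sup>2 + (sin \<theta>)\<^sup>2 = 1" by simp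
  have "(cvec_norm (G i))\<^sup>2 + (cvec_norm (G j))\<^sup>2 = (cvec_norm (F i))\<^sup>2 + (cvec_norm (F j))\<^sup>2"
    unfolding Gi Gj cvec_norm_sq[OF mix] cvec_norm_sq[OF Fij(1)] cvec_norm_sq[OF Fij(2)] sum.distrib[symmetric]
    using rot[OF cs] by (intro sum.cong refl) (simp add: mix_def)
  moreover have Gt: "(cvec_norm (G i))\<^sup>2 = t" using \<theta> unfolding Gi N_def .
  moreover have "frame_quad m G x = frame_quad m F x" if x: "x \<in> carrier_vec d" for x
  proof -
    have xm: "x \<bullet>c mix c s = complex_of_real c * (x \<bullet>c F i) + complex_of_real s * (x \<bullet>c F j)" for c s
      unfolding cinner_sum[OF mix] cinner_sum[OF Fij(1)] cinner_sum[OF Fij(2)]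
      by (simp add: mix_def sum_distrib_left sum.distrib algebra_simps)
    have split: "(\<Sum>k=1..m. h k) = h i + (h j + sum h ({1..m} - {i} - {j}))" for h :: "nat \<Rightarrow> real"
      using ij by (simp add: sum.remove[of _ i] sum.remove[of _ j])
    have "sum (\<lambda>k. (cmod (x \<bullet>c G k))\<^sup>2) ({1..m} - {i} - {j}) = sum (\<lambda>k. (cmod (x \<bullet>c F k))\<^sup>2) ({1..m} - {i} - {j})"
      by (intro sum.cong refl) (simp add: G_def)
    then show ?thesis
      unfolding frame_quad_def split Gi Gj xm using rot[OF cs, of "x \<bullet>c F i" "x \<bullet>c F j"] by linarith
  qed
  moreover have "\<forall>k\<in>{1..m}. G k \<in> carrier_vec d" using F mix by (simp add: G_def)
  moreover have "\<forall>k. k \<noteq> i \<longrightarrow> k \<noteq> j \<longrightarrow> G k = F k" by (simp add: G_def)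
  ultimately show ?thesis by (intro exI[of _ G]) auto
qed

text \<open>All vectors except possibly one, \<open>F i0\<close>, have squared norm 0 or \<open>b\<close>. A single rotation gives \<open>F i0\<close> its
target: if it is too short it is paired with a vector of squared norm \<open>b\<close>, if it is too long with a
zero vector. The partner becomes the new exceptional vector, and \<open>i0\<close> is removed from the index
set. A suitable partner can be missing only if \<open>F i0\<close> already has the right norm, because the
totals agree.\<close>

lemma redistribute_norms:
  assumes "finite I" "I \<subseteq> {1..m}" "\<forall>k\<in>{1..m}. F k \<in> carrier_vec d"
    and "\<forall>i\<in>I. (cvec_norm (F i))\<^sup>2 \<le> b" "\<forall>i\<in>I-{i0}. (cvec_norm (F i))\<^sup>2 \<in> {0, b}"
    and "\<forall>i\<in>I. 0 \<le> a i \<and> a i \<le> b" "(\<Sum>i\<in>I. (cvec_norm (F i))\<^sup>2) = (\<Sum>i\<in>I. a i)"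
  shows "\<exists>G. (\<forall>k\<in>{1..m}. G k \<in> carrier_vec d) \<and> (\<forall>k. k \<notin> I \<longrightarrow> G k = F k) \<and>
    (\<forall>x\<in>carrier_vec d. frame_quad m G x = frame_quad m F x) \<and> (\<forall>i\<in>I. (cvec_norm (G i))\<^sup>2 = a i)"
  using assms
proof (induction "card I" arbitrary: I F i0)
  case 0
  then show ?case by (intro exI[of _ F]) auto
next
  case (Suc n)
  define y where "y H i = (cvec_norm (H i))\<^sup>2" for H :: "nat \<Rightarrow> complex vec" and i
  note prems = Suc.prems[folded y_def]
  obtain i where i: "i \<in> I" "\<forall>k\<in>I-{i}. y F k \<in> {0, b}"
  proof (cases "i0 \<in> I")
    case False
    moreover from Suc.hyps(2) have "I \<noteq> {}" by auto
    ultimately show ?thesis using prems(5) that by blast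
  qed (use prems(5) that in blast)
  have i': "i \<in> {1..m}" using i prems(2) by auto
  have I: "finite (I - {i})" "I - {i} \<subseteq> {1..m}" "n = card (I - {i})"
    using prems(1,2) i(1) Suc.hyps(2) by auto
  have a: "0 \<le> a i" "a i \<le> b" using prems(6) i(1) by auto
  have sumI: "sum h I = h i + sum h (I - {i})" for h :: "nat \<Rightarrow> real"
    using prems(1) i(1) by (rule sum.remove)
  have y0: "0 \<le> y H k" for H k by (simp add: y_def)
  have "\<exists>G j. (\<forall>k\<in>{1..m}. G k \<in> carrier_vec d) \<and> (\<forall>k. k \<notin> I \<longrightarrow> G k = F k) \<and>
      (\<forall>x\<in>carrier_vec d. frame_quad m G x = frame_quad m F x) \<and> y G i = a i \<and>
      (\<forall>k\<in>I-{i}. y G k \<le> b) \<and> (\<forall>k\<in>I-{i}-{j}. y G k \<in> {0, b}) \<and> sum (y G) I = sum (y F) I"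
  proof -
    have step: ?thesis if j: "j \<in> I - {i}" and G: "\<forall>k\<in>{1..m}. G k \<in> carrier_vec d"
      "\<forall>k. k \<noteq> i \<longrightarrow> k \<noteq> j \<longrightarrow> G k = F k"
      "\<forall>x\<in>carrier_vec d. frame_quad m G x = frame_quad m F x"
      "y G i = a i" "y G i + y G j = y F i + y F j" "y G j \<le> b" for G j
    proof (intro exI[of _ G] exI[of _ j] conjI)
      have yG: "y G k = y F k" if "k \<noteq> i" "k \<noteq> j" for k using G(2) that by (simp add: y_def)
      show "\<forall>k\<in>I-{i}. y G k \<le> b"
      proof
        fix k assume "k \<in> I - {i}"
        then show "y G k \<le> b" using yG[of k] G(6) prems(4) by (cases "k = j") auto
      qed
      show "\<forall>k\<in>I-{i}-{j}. y G k \<in> {0, b}" using yG i(2) by auto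
      have "sum (y G) (I - {i} - {j}) = sum (y F) (I - {i} - {j})"
        by (intro sum.cong refl yG) auto
      then show "sum (y G) I = sum (y F) I"
        unfolding sumI using sum.remove[OF I(1) j, of "y G"] sum.remove[OF I(1) j, of "y F"] G(5) by linarith
    qed (use G i j in auto)
    show ?thesis
    proof (cases "y F i < a i")
      case True
      have "\<exists>j\<in>I-{i}. y F j = b"
      proof (rule ccontr)
        assume "\<not> ?thesis"
        then have "sum (y F) (I - {i}) = 0" using i(2) by (intro sum.neutral) auto
        moreover have "0 \<le> sum a (I - {i})" using prems(6) by (intro sum_nonneg) auto
        ultimately show False using prems(7) True unfolding sumI by linarith
      qed
      then obtain j where j: "j \<in> I - {i}" "y F j = b" by blast
      have jm: "j \<in> {1..m}" "j \<noteq> i" using j I(2) by auto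
      have t: "y F i \<le> b + y F i - a i" "b + y F i - a i \<le> y F j" using True a j by auto
      obtain G where G: "\<forall>k\<in>{1..m}. G k \<in> carrier_vec d" "\<forall>k. k \<noteq> j \<longrightarrow> k \<noteq> i \<longrightarrow> G k = F k"
        "\<forall>x\<in>carrier_vec d. frame_quad m G x = frame_quad m F x"
        "y G j = b + y F i - a i" "y G i = y F j + y F i - (b + y F i - a i)"
        using frame_rotate[OF prems(3) jm(1) i' jm(2), folded y_def, OF t] by blast
      show ?thesis
      proof (rule step[OF j(1) G(1)])
        show "\<forall>k. k \<noteq> i \<longrightarrow> k \<noteq> j \<longrightarrow> G k = F k" using G(2) by blast
        show "y G i = a i" "y G i + y G j = y F i + y F j" "y G j \<le> b"
          unfolding G(4,5) using j(2) True by auto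
      qed (rule G(3))
    next
      case ge: False
      show ?thesis
      proof (cases "\<exists>j\<in>I-{i}. y F j = 0")
        case True
        then obtain j where j: "j \<in> I - {i}" "y F j = 0" by blast
        have jm: "j \<in> {1..m}" "i \<noteq> j" using j I(2) by auto
        have t: "y F j \<le> a i" "a i \<le> y F i" using ge a j by auto
        obtain G where G: "\<forall>k\<in>{1..m}. G k \<in> carrier_vec d" "\<forall>k. k \<noteq> i \<longrightarrow> k \<noteq> j \<longrightarrow> G k = F k"
          "\<forall>x\<in>carrier_vec d. frame_quad m G x = frame_quad m F x"
          "y G i = a i" "y G j = y F i + y F j - a i"
          using frame_rotate[OF prems(3) i' jm, folded y_def, OF t] by blast
        show ?thesis
        proof (rule step[OF j(1) G(1-4)])
          show "y G i + y G j = y F i + y F j" unfolding G(4,5) by simp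
          show "y G j \<le> b" unfolding G(5) using j(2) a(1) prems(4) i(1) by force
        qed
      next
        case False
        then have "sum (y F) (I - {i}) = sum (\<lambda>_. b) (I - {i})" using i(2) by (intro sum.cong refl) auto
        moreover have "sum a (I - {i}) \<le> sum (\<lambda>_. b) (I - {i})" using prems(6) by (intro sum_mono) auto
        ultimately have "y F i = a i" using prems(7) ge unfolding sumI by linarith
        then show ?thesis using prems i by (intro exI[of _ F]) auto
      qed
    qed
  qed
  then obtain G j where G: "\<forall>k\<in>{1..m}. G k \<in> carrier_vec d" "\<forall>k. k \<notin> I \<longrightarrow> G k = F k"
      "\<forall>x\<in>carrier_vec d. frame_quad m G x = frame_quad m F x" "y G i = a i"
      "\<forall>k\<in>I-{i}. y G k \<le> b" "\<forall>k\<in>I-{i}-{j}. y G k \<in> {0, b}" "sum (y G) I = sum (y F) I"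
    by (elim exE conjE)
  have "sum (y G) (I - {i}) = sum a (I - {i})" using G(4,7) prems(7) unfolding sumI by linarith
  moreover have "\<forall>k\<in>I-{i}. 0 \<le> a k \<and> a k \<le> b" using prems(6) by auto
  ultimately obtain H where H: "\<forall>k\<in>{1..m}. H k \<in> carrier_vec d" "\<forall>k. k \<notin> I - {i} \<longrightarrow> H k = G k"
    "\<forall>x\<in>carrier_vec d. frame_quad m H x = frame_quad m G x" "\<forall>k\<in>I-{i}. y H k = a k"
    using Suc.hyps(1)[OF I(3,1,2) G(1), folded y_def, OF G(5,6)] by blast
  show ?case unfolding y_def[symmetric]
  proof (intro exI[of _ H] conjI)
    show "\<forall>k\<in>I. y H k = a k" using H(2,4) G(4) by (auto simp: y_def)
  qed (use H G in auto)
qed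

text \<open>A diagonal frame operator is realized by scaled basis vectors, padded with zero vectors.\<close>

lemma scaled_basis_frame:
  assumes e: "orthonormal_on d {1..d} e" and d: "d \<le> m" and \<mu>: "\<And>i. i \<in> {1..d} \<Longrightarrow> 0 \<le> \<mu> i"
  shows "\<exists>F. (\<forall>k\<in>{1..m}. F k \<in> carrier_vec d) \<and>
    (\<forall>k\<in>{1..m}. (cvec_norm (F k))\<^sup>2 = (if k \<le> d then \<mu> k else 0)) \<and>
    (\<forall>x\<in>carrier_vec d. frame_quad m F x = (\<Sum>i=1..d. \<mu> i * (cmod (x \<bullet>c e i))\<^sup>2))"
proof -
  define F where "F k = (if k \<le> d then complex_of_real (sqrt (\<mu> k)) \<cdot>\<^sub>v e k else 0\<^sub>v d)" for k
  have ec: "e i \<in> carrier_vec d" "(cvec_norm (e i))\<^sup>2 = 1" if "i \<in> {1..d}" for i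
  proof -
    show "e i \<in> carrier_vec d" using e that by (auto simp: orthonormal_on_def)
    show "(cvec_norm (e i))\<^sup>2 = 1" using e that by (intro cvec_norm_sq_eq_1) (auto simp: orthonormal_on_def)
  qed
  have Fc: "F k \<in> carrier_vec d" if "k \<in> {1..m}" for k using ec that by (auto simp: F_def)
  have "(cvec_norm (F k))\<^sup>2 = (if k \<le> d then \<mu> k else 0)" if "k \<in> {1..m}" for k
  proof (cases "k \<le> d")
    case True
    then have "k \<in> {1..d}" using that by auto
    then show ?thesis using cvec_norm_smult[OF ec(1), of k "complex_of_real (sqrt (\<mu> k))"] ec \<mu> True by (simp add: F_def)
  qed (simp add: F_def cvec_norm_sq[of _ d])
  moreover have "frame_quad m F x = (\<Sum>i=1..d. \<mu> i * (cmod (x \<bullet>c e i))\<^sup>2)" if x: "x \<in> carrier_vec d" for x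
  proof -
    have "frame_quad m F x = (\<Sum>i=1..d. (cmod (x \<bullet>c F i))\<^sup>2)"
      unfolding frame_quad_def
    proof (rule sum.mono_neutral_right)
      show "\<forall>i\<in>{1..m} - {1..d}. (cmod (x \<bullet>c F i))\<^sup>2 = 0"
        using x by (auto simp: F_def cinner_sum[where d = d])
    qed (use d in auto)
    also have "\<dots> = (\<Sum>i=1..d. \<mu> i * (cmod (x \<bullet>c e i))\<^sup>2)"
    proof (rule sum.cong[OF refl])
      fix i assume i: "i \<in> {1..d}"
      then show "(cmod (x \<bullet>c F i))\<^sup>2 = \<mu> i * (cmod (x \<bullet>c e i))\<^sup>2"
        using cinner_smult(2)[OF x ec(1)[OF i]] \<mu>[OF i] by (simp add: F_def norm_mult power_mult_distrib)
    qed
    finally show ?thesis .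
  qed
  ultimately show ?thesis using Fc by blast
qed

text \<open>The starting point is the frame of scaled basis vectors; its vectors beyond the index \<open>r\<close> have
squared norms \<open>b\<close> and 0, and rotations redistribute these to the prescribed values.\<close>

lemma prescribed_norm_frame_exists:
  assumes e: "orthonormal_on d {1..d} e" and d: "d \<le> m" and \<mu>: "\<And>i. i \<in> {1..d} \<Longrightarrow> 0 \<le> \<mu> i"
    and r: "r < d" and head: "\<And>i. i \<in> {1..r} \<Longrightarrow> a i = \<mu> i" and tail: "\<And>i. i \<in> {r+1..d} \<Longrightarrow> \<mu> i = b"
    and a: "\<And>i. i \<in> {r+1..m} \<Longrightarrow> 0 \<le> a i \<and> a i \<le> b" and sum: "(\<Sum>i=r+1..m. a i) = real (d - r) * b"
  shows "\<exists>G\<in>prescribed_norm_seqs d m a.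
    \<forall>x\<in>carrier_vec d. frame_quad m G x = (\<Sum>i=1..d. \<mu> i * (cmod (x \<bullet>c e i))\<^sup>2)"
proof -
  obtain F where F: "\<forall>k\<in>{1..m}. F k \<in> carrier_vec d"
    "\<forall>k\<in>{1..m}. (cvec_norm (F k))\<^sup>2 = (if k \<le> d then \<mu> k else 0)"
    "\<forall>x\<in>carrier_vec d. frame_quad m F x = (\<Sum>i=1..d. \<mu> i * (cmod (x \<bullet>c e i))\<^sup>2)"
    using scaled_basis_frame[OF e d, of \<mu>] \<mu> by blast
  have Ft: "(cvec_norm (F k))\<^sup>2 = (if k \<le> d then b else 0)" if "k \<in> {r+1..m}" for k
    using F(2) tail that by auto
  have b: "0 \<le> b" using a[of "r+1"] r d by auto
  have "(\<Sum>i\<in>{r+1..m}. (cvec_norm (F i))\<^sup>2) = (\<Sum>i\<in>{r+1..m}. if i \<le> d then b else 0)"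
    by (intro sum.cong refl Ft)
  also have "\<dots> = (\<Sum>i\<in>{r+1..d}. b)"
    using d by (intro sum.mono_neutral_cong_right) auto
  also have "\<dots> = (\<Sum>i\<in>{r+1..m}. a i)" using sum by simp
  finally have s: "(\<Sum>i\<in>{r+1..m}. (cvec_norm (F i))\<^sup>2) = (\<Sum>i\<in>{r+1..m}. a i)" .
  have "\<forall>i\<in>{r+1..m}. (cvec_norm (F i))\<^sup>2 \<le> b" "\<forall>i\<in>{r+1..m}-{0}. (cvec_norm (F i))\<^sup>2 \<in> {0, b}"
    "\<forall>i\<in>{r+1..m}. 0 \<le> a i \<and> a i \<le> b" "{r+1..m} \<subseteq> {1..m}"
    using Ft a b by auto
  from redistribute_norms[OF finite_atLeastAtMost this(4) F(1) this(1-3) s]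
  obtain G where G: "\<forall>k\<in>{1..m}. G k \<in> carrier_vec d" "\<forall>k. k \<notin> {r+1..m} \<longrightarrow> G k = F k"
    "\<forall>x\<in>carrier_vec d. frame_quad m G x = frame_quad m F x" "\<forall>i\<in>{r+1..m}. (cvec_norm (G i))\<^sup>2 = a i"
    by blast
  have "(cvec_norm (G i))\<^sup>2 = a i" if i: "i \<in> {1..m}" for i
  proof (cases "i \<le> r")
    case True
    then have "G i = F i" "i \<in> {1..r}" "i \<le> d" using G(2) i r by auto
    then show ?thesis using F(2) head i by simp
  qed (use G(4) i in auto)
  then show ?thesis using G F(3) by (intro bexI[of _ G]) (auto simp: prescribed_norm_seqs_def)
qed

section \<open>The irregularity\<close>

text \<open>With \<open>b\<close> the average weight available per remaining dimension, the defining inequality at the index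
\<open>r\<close> says that \<open>a r > b\<close> (if \<open>r\<close> is positive), and its failure at \<open>r + 1\<close> says that
\<open>a (r + 1) \<le> b\<close>; for \<open>r + 1 = d\<close> the latter holds because \<open>b\<close> is the whole remaining sum. Hence
\<open>a 1, \<dots>, a r, b, \<dots>, b\<close> is decreasing, and the tail of \<open>a\<close> can be redistributed.\<close>

lemma irregularity_properties:
  assumes d: "0 < d" "d \<le> m" and a: "\<And>i. i \<in> {1..m} \<Longrightarrow> 0 < a i" "antimono_on {1..m} a"
  defines "r \<equiv> irregularity d m a"
  defines "b \<equiv> (\<Sum>i=r+1..m. a i) / real (d - r)"
  shows "r < d" "0 < b" "i \<in> {r+1..m} \<Longrightarrow> a i \<le> b" "i \<in> {1..r} \<Longrightarrow> b \<le> a i"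
proof -
  define J where "J = {j. 1 \<le> j \<and> j \<le> d - 1 \<and> real (d - j) * a j > (\<Sum>i=j+1..m. a i)}"
  have r_J: "r = (if J = {} then 0 else Max J)"
    by (simp only: r_def irregularity_def J_def Let_def)
  have finJ: "finite J" by (rule finite_subset[of _ "{..d-1}"]) (auto simp: J_def)
  have rJ: "r \<in> J" if "r \<noteq> 0" using that r_J Max_in[OF finJ] by (auto split: if_splits)
  show r: "r < d" using rJ d(1) by (cases "r = 0") (auto simp: J_def)
  have mono: "a j \<le> a i" if "1 \<le> i" "i \<le> j" "j \<le> m" for i j
    using a(2) that unfolding monotone_on_def by auto
  show "0 < b" unfolding b_def using r d by (intro divide_pos_pos sum_pos a(1)) auto
  have b: "real (d - r) * b = (\<Sum>i=r+1..m. a i)" using r by (simp add: b_def)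
  have split: "(\<Sum>i=r+1..m. a i) = a (r+1) + (\<Sum>i=r+2..m. a i)"
    using r d by (simp add: sum.atLeast_Suc_atMost)
  have "a (r + 1) \<le> b"
  proof (cases "r + 1 = d")
    case True
    have "0 \<le> (\<Sum>i=r+2..m. a i)" by (intro sum_nonneg less_imp_le a(1)) auto
    then show ?thesis using b split True by (simp flip: True)
  next
    case False
    have "r + 1 \<notin> J"
    proof
      assume "r + 1 \<in> J"
      moreover from this have "r = Max J" using r_J by auto
      ultimately have "r + 1 \<le> r" using Max_ge[OF finJ] by blast
      then show False by simp
    qed
    then have "real (d - (r + 1)) * a (r + 1) \<le> (\<Sum>i=r+2..m. a i)"
      using False r by (simp add: J_def not_less)
    moreover have "real (d - r) = real (d - (r + 1)) + 1" using False r by linarith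
    ultimately have "real (d - r) * a (r + 1) \<le> real (d - r) * b"
      unfolding b split by (simp add: algebra_simps)
    then show ?thesis using r by simp
  qed
  then show "a i \<le> b" if "i \<in> {r+1..m}" using mono[of "r+1" i] that by auto
  show "b \<le> a i" if i: "i \<in> {1..r}"
  proof -
    have "r \<in> J" using rJ i by auto
    then have "real (d - r) * b \<le> real (d - r) * a r" unfolding b by (simp add: J_def)
    then have "b \<le> a r" using r by simp
    also have "\<dots> \<le> a i" using mono i r d by auto
    finally show ?thesis .
  qed
qed

section \<open>Frames of the optimal form\<close>

lemma cspan_orthogonal:
  assumes x: "x \<in> cspan d S" and S: "S \<subseteq> carrier_vec d"
  shows "x \<in> carrier_vec d"
    and "y \<in> carrier_vec d \<Longrightarrow> (\<And>v. v \<in> S \<Longrightarrow> v \<bullet>c y = 0) \<Longrightarrow> x \<bullet>c y = 0"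
proof -
  interpret vec_space "TYPE(complex)" d .
  obtain c A where A: "x = lincomb c A" "finite A" "A \<subseteq> S" using in_spanE[OF x] by blast
  have Ac: "A \<subseteq> carrier_vec d" using A(3) S by blast
  have "dim_vec x = d" unfolding A(1) by (rule lincomb_dim[OF A(2) Ac])
  then show "x \<in> carrier_vec d" by (rule carrier_vecI)
  have "x = vec d (\<lambda>p. \<Sum>v\<in>A. c v * v $ p)"
    using \<open>dim_vec x = d\<close> lincomb_index[OF _ Ac] by (intro eq_vecI) (auto simp: A(1))
  then show "x \<bullet>c y = 0" if "y \<in> carrier_vec d" "\<And>v. v \<in> S \<Longrightarrow> v \<bullet>c y = 0"
    using cinner_lincomb[OF that(1) A(2), of c "\<lambda>v. v"] that(2) A(3) by (auto intro!: sum.neutral)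
qed

lemma in_cspan_orthonormal:
  assumes e: "orthonormal_on d {1..d} e" and J: "J \<subseteq> {1..d}" and x: "x \<in> carrier_vec d"
    and orth: "\<And>i. i \<in> {1..d} - J \<Longrightarrow> x \<bullet>c e i = 0"
  shows "x \<in> cspan d (e ` J)"
proof -
  interpret vec_space "TYPE(complex)" d .
  have ec: "e ` J \<subseteq> carrier_vec d" using e J by (auto simp: orthonormal_on_def)
  have fin: "finite (e ` J)" using J finite_subset by blast
  have inj: "inj_on e J"
  proof (rule inj_onI)
    fix i j assume "i \<in> J" "j \<in> J" "e i = e j"
    then have "i \<in> {1..d}" "j \<in> {1..d}" "e i \<bullet>c e i = e i \<bullet>c e j" using J by auto
    then show "i = j" using e unfolding orthonormal_on_def by (metis zero_neq_one)
  qed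
  have "x = lincomb (\<lambda>v. x \<bullet>c v) (e ` J)"
  proof (rule eq_vecI)
    fix p assume "p < dim_vec (lincomb (\<lambda>v. x \<bullet>c v) (e ` J))"
    then have p: "p < d" using lincomb_dim[OF fin ec] by simp
    have "x $ p = (\<Sum>i\<in>J. (x \<bullet>c e i) * e i $ p)"
      unfolding vec_sum_orthonormal[OF e x p] using J orth by (intro sum.mono_neutral_right) auto
    then show "x $ p = lincomb (\<lambda>v. x \<bullet>c v) (e ` J) $ p"
      unfolding lincomb_index[OF p ec] sum.reindex[OF inj] by simp
  qed (use lincomb_dim[OF fin ec] x in auto)
  then show ?thesis using fin by (rule in_spanI) simp
qed

text \<open>The tail is a tight frame for the span of the remaining basis vectors and does not see the first \<open>r\<close>
of them, so the quadratic form is diagonal in the basis \<open>e\<close>. The frame constant is then determined by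
the trace.\<close>

lemma canonical_frame_quad:
  assumes e: "orthonormal_on d {1..d} e" and F: "F \<in> prescribed_norm_seqs d m a"
    and a: "\<And>i. i \<in> {1..m} \<Longrightarrow> 0 \<le> a i" and d: "d \<le> m" and can: "canonical_form d m a e F"
    and r: "r = irregularity d m a" "r < d" and b: "real (d - r) * b = (\<Sum>i=r+1..m. a i)"
    and x: "x \<in> carrier_vec d"
  shows "frame_quad m F x = (\<Sum>i=1..d. (if i \<le> r then a i else b) * (cmod (x \<bullet>c e i))\<^sup>2)"
proof -
  define W where "W = cspan d (e ` {r+1..d})"
  have ec: "e i \<in> carrier_vec d" if "i \<in> {1..d}" for i using e that by (auto simp: orthonormal_on_def)
  have eo: "e i \<bullet>c e j = (if i = j then 1 else 0)" if "i \<in> {1..d}" "j \<in> {1..d}" for i j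
    using e that by (auto simp: orthonormal_on_def)
  have Fc: "\<forall>k\<in>{1..m}. F k \<in> carrier_vec d" and Fn: "\<And>k. k \<in> {1..m} \<Longrightarrow> (cvec_norm (F k))\<^sup>2 = a k"
    using F by (auto simp: prescribed_norm_seqs_def)
  have head: "F i = complex_of_real (sqrt (a i)) \<cdot>\<^sub>v e i" if "i \<in> {1..r}" for i
    using can that by (simp add: canonical_form_def r(1) Let_def)
  obtain \<alpha> where FW: "\<forall>k\<in>{r+1..m}. F k \<in> W"
    and \<alpha>: "\<forall>x\<in>W. (\<Sum>k\<in>{r+1..m}. (cmod (x \<bullet>c F k))\<^sup>2) = \<alpha> * (cvec_norm x)\<^sup>2"
    using can by (auto simp: canonical_form_def r(1)[symmetric] tight_frame_def W_def Let_def)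
  have quad: "frame_quad m F x = (\<Sum>i=1..d. (if i \<le> r then a i else \<alpha>) * (cmod (x \<bullet>c e i))\<^sup>2)"
    if x: "x \<in> carrier_vec d" for x
  proof -
    \<comment> \<open>The orthogonal projection of \<open>x\<close> to the span of the tail.\<close>
    define y where "y = vec d (\<lambda>p. \<Sum>i\<in>{r+1..d}. (x \<bullet>c e i) * e i $ p)"
    have y: "y \<in> carrier_vec d" by (simp add: y_def)
    have yz: "y \<bullet>c z = (\<Sum>i\<in>{r+1..d}. (x \<bullet>c e i) * (e i \<bullet>c z))" if "z \<in> carrier_vec d" for z
      unfolding y_def using that by (rule cinner_lincomb) simp
    have ye: "y \<bullet>c e j = (if j \<le> r then 0 else x \<bullet>c e j)" if j: "j \<in> {1..d}" for j
    proof -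
      have "y \<bullet>c e j = (\<Sum>i\<in>{r+1..d}. (x \<bullet>c e i) * (if i = j then 1 else 0))"
        unfolding yz[OF ec[OF j]] using j by (intro sum.cong refl) (auto simp: eo)
      then show ?thesis using j by (auto simp: if_distrib sum.delta' cong: if_cong)
    qed
    have yW: "y \<in> W" unfolding W_def by (rule in_cspan_orthonormal[OF e _ y]) (use ye in auto)
    have "x \<bullet>c F k = y \<bullet>c F k" if k: "k \<in> {r+1..m}" for k
    proof -
      have Fk: "F k \<in> carrier_vec d" using Fc k by auto
      have "e i \<bullet>c F k = 0" if i: "i \<in> {1..r}" for i
      proof -
        have i': "i \<in> {1..d}" using i r(2) by auto
        have "F k \<in> cspan d (e ` {r+1..d})" using FW k unfolding W_def by blast
        then have "F k \<bullet>c e i = 0"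
          by (rule cspan_orthogonal(2)) (use ec i i' eo in auto)
        then show ?thesis using cinner_commute[OF Fk ec[OF i']] by simp
      qed
      then have "(\<Sum>i=1..d. (x \<bullet>c e i) * (e i \<bullet>c F k)) = (\<Sum>i\<in>{r+1..d}. (x \<bullet>c e i) * (e i \<bullet>c F k))"
        by (intro sum.mono_neutral_right) auto
      then show ?thesis unfolding yz[OF Fk] using parseval_cinner[OF e x Fk] by simp
    qed
    then have "(\<Sum>k=r+1..m. (cmod (x \<bullet>c F k))\<^sup>2) = \<alpha> * (cvec_norm y)\<^sup>2"
      using \<alpha> yW by simp
    also have "(cvec_norm y)\<^sup>2 = (\<Sum>i=1..d. (cmod (if i \<le> r then 0 else x \<bullet>c e i))\<^sup>2)"
      unfolding parseval_norm[OF e y, symmetric] by (intro sum.cong refl) (simp add: ye)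
    also have "\<dots> = (\<Sum>i=r+1..d. (cmod (x \<bullet>c e i))\<^sup>2)" by (intro sum.mono_neutral_cong_right) auto
    finally have tail: "(\<Sum>k=r+1..m. (cmod (x \<bullet>c F k))\<^sup>2) = (\<Sum>i=r+1..d. \<alpha> * (cmod (x \<bullet>c e i))\<^sup>2)"
      by (simp add: sum_distrib_left)
    have h: "(\<Sum>k=1..r. (cmod (x \<bullet>c F k))\<^sup>2) = (\<Sum>i=1..r. a i * (cmod (x \<bullet>c e i))\<^sup>2)"
    proof (rule sum.cong[OF refl])
      fix i assume i: "i \<in> {1..r}"
      then have "i \<in> {1..d}" "0 \<le> a i" using r(2) d a by auto
      then show "(cmod (x \<bullet>c F i))\<^sup>2 = a i * (cmod (x \<bullet>c e i))\<^sup>2"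
        unfolding head[OF i] using cinner_smult(2)[OF x ec] by (simp add: norm_mult power_mult_distrib)
    qed
    have "(\<Sum>i=1..d. (if i \<le> r then a i else \<alpha>) * (cmod (x \<bullet>c e i))\<^sup>2)
        = (\<Sum>i=1..r. a i * (cmod (x \<bullet>c e i))\<^sup>2) + (\<Sum>i=r+1..d. \<alpha> * (cmod (x \<bullet>c e i))\<^sup>2)"
      using r(2) sum.ub_add_nat[of 1 r "\<lambda>i. (if i \<le> r then a i else \<alpha>) * (cmod (x \<bullet>c e i))\<^sup>2" "d - r"]
      by simp
    moreover have "frame_quad m F x = (\<Sum>k=1..r. (cmod (x \<bullet>c F k))\<^sup>2) + (\<Sum>k=r+1..m. (cmod (x \<bullet>c F k))\<^sup>2)"
      unfolding frame_quad_def using sum.ub_add_nat[of 1 r _ "m - r"] r(2) d by simp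
    ultimately show ?thesis using h tail by simp
  qed
  have "(\<Sum>i=1..m. a i) = (\<Sum>k=1..m. (cvec_norm (F k))\<^sup>2)" using Fn by (intro sum.cong) auto
  also have "\<dots> = (\<Sum>i=1..d. frame_quad m F (e i))" by (rule frame_trace[OF Fc e, symmetric])
  also have "\<dots> = (\<Sum>i=1..d. if i \<le> r then a i else \<alpha>)"
  proof (rule sum.cong[OF refl])
    fix i assume i: "i \<in> {1..d}"
    have "frame_quad m F (e i) = (\<Sum>j=1..d. if j = i then (if i \<le> r then a i else \<alpha>) else 0)"
      unfolding quad[OF ec[OF i]] using i by (intro sum.cong refl) (auto simp: eo)
    also have "\<dots> = (if i \<le> r then a i else \<alpha>)" using i by (subst sum.delta) auto
    finally show "frame_quad m F (e i) = (if i \<le> r then a i else \<alpha>)" .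
  qed
  also have "\<dots> = (\<Sum>i=1..r. a i) + (\<Sum>i=r+1..d. \<alpha>)"
    using sum.ub_add_nat[of 1 r "\<lambda>i. if i \<le> r then a i else \<alpha>" "d - r"] r(2) by simp
  also have "(\<Sum>i=1..m. a i) = (\<Sum>i=1..r. a i) + (\<Sum>i=r+1..m. a i)"
    using sum.ub_add_nat[of 1 r a "m - r"] r(2) d by simp
  finally have "real (d - r) * \<alpha> = real (d - r) * b" unfolding b using r(2) by simp
  then have "\<alpha> = b" using r(2) by simp
  then show ?thesis using quad[OF x] by (simp only:)
qed

text \<open>Since the diagonal entries in the flag basis are exactly \<open>a 1, \<dots>, a r\<close>, the nonnegative remainder in
\<open>flag_basis_partial_sums\<close> vanishes. So each \<open>F i\<close> with \<open>i \<le> r\<close> is a multiple of \<open>u i\<close> and all later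
vectors are orthogonal to it; adjusting \<open>u i\<close> by a phase gives \<open>e i\<close>. The remaining vectors live in
the eigenspace where the frame operator is \<open>b\<close> times the identity, which is tightness.\<close>

lemma canonical_form_of_spectrum:
  assumes F: "F \<in> prescribed_norm_seqs d m a" and d: "d \<le> m"
    and a: "\<And>i. i \<in> {1..m} \<Longrightarrow> 0 < a i"
    and r: "r = irregularity d m a" "r < d" and b: "0 < b"
    and u: "orthonormal_on d {1..d} u" and flag: "\<forall>i\<in>{1..d}. \<forall>j\<in>{1..<i}. F j \<bullet>c u i = 0"
    and spec: "\<And>x c. x \<in> carrier_vec d \<Longrightarrow>
      (\<And>i. i \<in> {1..d} \<Longrightarrow> x \<bullet>c u i \<noteq> 0 \<Longrightarrow> (if i \<le> r then a i else b) = c) \<Longrightarrow>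
      frame_quad m F x = c * (cvec_norm x)\<^sup>2"
  shows "\<exists>e. orthonormal_basis d e \<and> canonical_form d m a e F"
proof -
  have uc: "u i \<in> carrier_vec d" if "i \<in> {1..d}" for i using u that by (auto simp: orthonormal_on_def)
  have uo: "u i \<bullet>c u j = (if i = j then 1 else 0)" if "i \<in> {1..d}" "j \<in> {1..d}" for i j
    using u that by (auto simp: orthonormal_on_def)
  have Fc: "\<forall>k\<in>{1..m}. F k \<in> carrier_vec d" and Fn: "\<And>k. k \<in> {1..m} \<Longrightarrow> (cvec_norm (F k))\<^sup>2 = a k"
    using F by (auto simp: prescribed_norm_seqs_def)
  have quad_u: "frame_quad m F (u i) = a i" if i: "i \<in> {1..r}" for i
  proof -
    have i': "i \<in> {1..d}" using i r(2) by auto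
    have "(cvec_norm (u i))\<^sup>2 = 1" using uo[OF i' i'] by (intro cvec_norm_sq_eq_1) simp
    moreover have "frame_quad m F (u i) = a i * (cvec_norm (u i))\<^sup>2"
    proof (rule spec[OF uc[OF i']])
      fix j assume "j \<in> {1..d}" "u i \<bullet>c u j \<noteq> 0"
      then have "j = i" using uo[OF i'] by (auto split: if_splits)
      then show "(if j \<le> r then a j else b) = a i" using i by simp
    qed
    ultimately show ?thesis by simp
  qed
  have ortho: "F k \<bullet>c u i = 0" if i: "i \<in> {1..r}" and k: "k \<in> {i+1..m}" for i k
  proof -
    have "(\<Sum>j=1..i. frame_quad m F (u j)) = (\<Sum>j=1..i. (cvec_norm (F j))\<^sup>2)"
      using i r(2) d by (intro sum.cong refl) (simp add: quad_u Fn)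
    then have "(\<Sum>k=i+1..m. \<Sum>j=1..i. (cmod (F k \<bullet>c u j))\<^sup>2) = 0"
      using flag_basis_partial_sums[OF Fc u flag, of i] i r(2) d by simp
    then have "(\<Sum>j=1..i. (cmod (F k \<bullet>c u j))\<^sup>2) = 0"
      using k by (subst (asm) sum_nonneg_eq_0_iff) (auto intro!: sum_nonneg)
    then have "(cmod (F k \<bullet>c u i))\<^sup>2 = 0"
      using i by (subst (asm) sum_nonneg_eq_0_iff) auto
    then show ?thesis by simp
  qed
  \<comment> \<open>The only coefficient of \<open>F i\<close> in the basis \<open>u\<close>, for \<open>i \<le> r\<close>.\<close>
  define c where "c i = F i \<bullet>c u i" for i
  have F_u: "F i = c i \<cdot>\<^sub>v u i" "(cmod (c i))\<^sup>2 = a i" if i: "i \<in> {1..r}" for i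
  proof -
    have i': "i \<in> {1..d}" "i \<in> {1..m}" using i r(2) d by auto
    have Fi: "F i \<in> carrier_vec d" using Fc i' by auto
    have z: "F i \<bullet>c u j = (if j = i then c i else 0)" if j: "j \<in> {1..d}" for j
    proof (cases j i rule: linorder_cases)
      case less
      then show ?thesis using ortho[of j i] j i i' by auto
    next
      case greater
      then show ?thesis using flag i j by auto
    qed (simp add: c_def)
    have "F i $ p = c i * u i $ p" if p: "p < d" for p
    proof -
      have "F i $ p = (\<Sum>j=1..d. if j = i then c i * u i $ p else 0)"
        unfolding vec_sum_orthonormal[OF u Fi p] by (intro sum.cong refl) (simp add: z)
      then show ?thesis using i' by simp
    qed
    then show "F i = c i \<cdot>\<^sub>v u i" using Fi uc[OF i'(1)] by (intro eq_vecI) auto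
    have "a i = (\<Sum>j=1..d. if j = i then (cmod (c i))\<^sup>2 else 0)"
      unfolding Fn[OF i'(2), symmetric] parseval_norm[OF u Fi, symmetric]
      by (intro sum.cong refl) (simp add: z)
    then show "(cmod (c i))\<^sup>2 = a i" using i' by simp
  qed
  \<comment> \<open>The phases that turn \<open>F i = c i \<cdot>\<^sub>v u i\<close> into a positive multiple of \<open>e i\<close>.\<close>
  define \<omega> where "\<omega> i = (if i \<le> r then c i / complex_of_real (sqrt (a i)) else 1)" for i
  have \<omega>: "\<omega> i * cnj (\<omega> i) = 1" if "i \<in> {1..d}" for i
  proof (cases "i \<le> r")
    case True
    then have i: "i \<in> {1..r}" "i \<in> {1..m}" using that d by auto
    have "(cmod (\<omega> i))\<^sup>2 = 1"
      using True F_u(2)[OF i(1)] a[OF i(2)] by (simp add: \<omega>_def norm_divide power_divide)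
    then show ?thesis by (metis complex_norm_square of_real_1)
  qed (simp add: \<omega>_def)
  define e where "e i = \<omega> i \<cdot>\<^sub>v u i" for i
  have xe: "x \<bullet>c e i = cnj (\<omega> i) * (x \<bullet>c u i)" if "x \<in> carrier_vec d" "i \<in> {1..d}" for x i
    unfolding e_def by (rule cinner_smult(2)[OF that(1) uc[OF that(2)]])
  have xe0: "x \<bullet>c e i = 0 \<longleftrightarrow> x \<bullet>c u i = 0" if "x \<in> carrier_vec d" "i \<in> {1..d}" for x i
    using xe[OF that] \<omega>[OF that(2)] by auto
  have ec: "e i \<in> carrier_vec d" if "i \<in> {1..d}" for i using uc[OF that] by (simp add: e_def)
  have eo: "e i \<bullet>c e j = (if i = j then 1 else 0)" if ij: "i \<in> {1..d}" "j \<in> {1..d}" for i j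
  proof -
    have "e i \<bullet>c u j = \<omega> i * (u i \<bullet>c u j)"
      unfolding e_def by (rule cinner_smult(1)[OF uc[OF ij(1)] uc[OF ij(2)]])
    then have "e i \<bullet>c e j = \<omega> i * cnj (\<omega> j) * (u i \<bullet>c u j)"
      using xe[OF ec[OF ij(1)] ij(2)] by simp
    then show ?thesis using uo[OF ij] \<omega>[OF ij(1)] by (cases "i = j") simp_all
  qed
  have e: "orthonormal_on d {1..d} e" using ec eo by (simp add: orthonormal_on_def)
  have "cspan d (e ` {1..d}) = carrier_vec d"
  proof
    show "cspan d (e ` {1..d}) \<subseteq> carrier_vec d"
    proof
      fix x assume "x \<in> cspan d (e ` {1..d})"
      then show "x \<in> carrier_vec d" by (rule cspan_orthogonal(1)) (use ec in auto)
    qed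
    show "carrier_vec d \<subseteq> cspan d (e ` {1..d})"
    proof
      fix x :: "complex vec" assume "x \<in> carrier_vec d"
      then show "x \<in> cspan d (e ` {1..d})" by (rule in_cspan_orthonormal[OF e order.refl]) auto
    qed
  qed
  then have basis: "orthonormal_basis d e" using ec eo by (auto simp: orthonormal_basis_def)
  have head: "F i = complex_of_real (sqrt (a i)) \<cdot>\<^sub>v e i" if i: "i \<in> {1..r}" for i
  proof -
    have "0 < a i" using a[of i] i r(2) d by auto
    then have "complex_of_real (sqrt (a i)) * \<omega> i = c i" using i by (simp add: \<omega>_def)
    then show ?thesis unfolding F_u(1)[OF i] e_def by (simp add: smult_smult_assoc)
  qed
  have "tight_frame (cspan d (e ` {r+1..d})) {r+1..m} F"
    unfolding tight_frame_def
  proof (intro conjI ballI exI[of _ b] b)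
    fix k assume k: "k \<in> {r+1..m}"
    then have Fk: "F k \<in> carrier_vec d" using Fc by auto
    show "F k \<in> cspan d (e ` {r+1..d})"
    proof (rule in_cspan_orthonormal[OF e _ Fk])
      fix i assume i: "i \<in> {1..d} - {r+1..d}"
      then show "F k \<bullet>c e i = 0" using ortho[of i k] k xe0[OF Fk, of i] by auto
    qed auto
  next
    fix x assume xW: "x \<in> cspan d (e ` {r+1..d})"
    have eW: "e ` {r+1..d} \<subseteq> carrier_vec d" using ec by auto
    have x: "x \<in> carrier_vec d" by (rule cspan_orthogonal(1)[OF xW eW])
    have xe_head: "x \<bullet>c e i = 0" if i: "i \<in> {1..r}" for i
      by (rule cspan_orthogonal(2)[OF xW eW]) (use i r(2) ec eo in auto)
    have "x \<bullet>c F k = 0" if k: "k \<in> {1..r}" for k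
    proof -
      have "k \<in> {1..d}" using k r(2) by auto
      then show ?thesis unfolding head[OF k] using cinner_smult(2)[OF x ec] xe_head[OF k] by simp
    qed
    then have "(\<Sum>k\<in>{r+1..m}. (cmod (x \<bullet>c F k))\<^sup>2) = frame_quad m F x"
      unfolding frame_quad_def by (intro sum.mono_neutral_left) auto
    also have "\<dots> = b * (cvec_norm x)\<^sup>2"
    proof (rule spec[OF x])
      fix i assume i: "i \<in> {1..d}" "x \<bullet>c u i \<noteq> 0"
      then have "\<not> i \<le> r" using xe_head[of i] xe0[OF x i(1)] by auto
      then show "(if i \<le> r then a i else b) = b" by simp
    qed
    finally show "(\<Sum>k\<in>{r+1..m}. (cmod (x \<bullet>c F k))\<^sup>2) = b * (cvec_norm x)\<^sup>2" .
  qed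
  then have "canonical_form d m a e F" using head by (simp add: canonical_form_def r(1) Let_def)
  then show ?thesis using basis by blast
qed

section \<open>Minimizers of the frame potential\<close>

theorem mainTheorem1:
  fixes d m :: nat and f :: "real \<Rightarrow> real" and c :: real and a :: "nat \<Rightarrow> real"
  assumes "0 < d" and "d \<le> m"
    and "convex_on {0..} f" and "\<forall>x\<ge>0. 0 \<le> f x"
    and "0 < c"
    and "\<forall>i\<in>{1..m}. 0 < a i" and "antimono_on {1..m} a"
  shows
    "((\<forall>F \<in> total_norm_seqs d m c. tight_frame (carrier_vec d) {1..m} F \<longrightarrow>
         is_arg_min (frame_potential d m f) (\<lambda>G. G \<in> total_norm_seqs d m c) F) \<and>
      (strictly_convex_on {0..} f \<longrightarrow>
         (\<forall>F. is_arg_min (frame_potential d m f) (\<lambda>G. G \<in> total_norm_seqs d m c) F \<longrightarrow>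
            tight_frame (carrier_vec d) {1..m} F))) \<and>
     ((\<forall>F \<in> prescribed_norm_seqs d m a. \<forall>e. orthonormal_basis d e \<and> canonical_form d m a e F \<longrightarrow>
         is_arg_min (frame_potential d m f) (\<lambda>G. G \<in> prescribed_norm_seqs d m a) F) \<and>
      (strictly_convex_on {0..} f \<longrightarrow>
         (\<forall>F. is_arg_min (frame_potential d m f) (\<lambda>G. G \<in> prescribed_norm_seqs d m a) F \<longrightarrow>
            (\<exists>e. orthonormal_basis d e \<and> canonical_form d m a e F))))"
proof -
  obtain w where w: "orthonormal_on d {1..d} w"
    using orthonormal_extend[of d 0] by (auto simp: orthonormal_on_def)

  \<comment> \<open>Prescribed total norm: the optimal spectrum is constant, and any orthonormal basis can serve
    in the lower bound because there are no partial sum conditions.\<close>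
  define \<beta> where "\<beta> = c / real d"
  have \<beta>: "0 < \<beta>" "real d * \<beta> = c" using assms(1,5) by (simp_all add: \<beta>_def)
  have A_carrier: "\<forall>i\<in>{1..m}. G i \<in> carrier_vec d" and A_norm: "(\<Sum>i=1..m. (cvec_norm (G i))\<^sup>2) = c"
    if "G \<in> total_norm_seqs d m c" for G using that by (auto simp: total_norm_seqs_def)
  have A_lower: "(\<Sum>i=1..d. f \<beta>) \<le> frame_potential d m f G" if G: "G \<in> total_norm_seqs d m c" for G
    by (rule frame_potential_lower_bound(1)[where r = 0 and \<mu> = "\<lambda>_. \<beta>", OF assms(3) A_carrier[OF G] w])
      (use \<beta> assms(1) A_norm[OF G] in \<open>auto intro: monotone_onI\<close>)
  have A_min: "is_arg_min (frame_potential d m f) (\<lambda>G. G \<in> total_norm_seqs d m c) F"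
    if F: "F \<in> total_norm_seqs d m c" and tight: "tight_frame (carrier_vec d) {1..m} F" for F
  proof -
    obtain \<alpha> where \<alpha>: "\<forall>x\<in>carrier_vec d. frame_quad m F x = \<alpha> * (cvec_norm x)\<^sup>2"
      using tight by (auto simp: tight_frame_def frame_quad_def)
    have "frame_quad m F (w i) = \<alpha>" if "i \<in> {1..d}" for i
    proof -
      have "w i \<in> carrier_vec d" "w i \<bullet>c w i = 1" using w that by (auto simp: orthonormal_on_def)
      moreover from this have "(cvec_norm (w i))\<^sup>2 = 1" by (intro cvec_norm_sq_eq_1)
      ultimately show ?thesis using \<alpha> by simp
    qed
    then have "(\<Sum>i=1..d. \<alpha>) = c"
      using frame_trace[OF A_carrier[OF F] w] A_norm[OF F] by simp
    then have "real d * \<alpha> = real d * \<beta>" using \<beta>(2) by simp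
    then have "\<alpha> = \<beta>" using assms(1) by simp
    have "frame_potential d m f F \<le> (\<Sum>i=1..d. f \<beta>)"
    proof (rule frame_potential_upper_bound[OF assms(3,1) A_carrier[OF F] w])
      show "frame_quad m F x = (\<Sum>i=1..d. \<beta> * (cmod (x \<bullet>c w i))\<^sup>2)" if "x \<in> carrier_vec d" for x
        using \<alpha> that \<open>\<alpha> = \<beta>\<close> parseval_norm[OF w that] by (simp add: sum_distrib_left[symmetric])
    qed (use \<beta> in auto)
    then show ?thesis using A_lower F by (force simp: is_arg_min_def)
  qed
  have A_unique: "tight_frame (carrier_vec d) {1..m} F"
    if strict: "strictly_convex_on {0..} f"
      and min: "is_arg_min (frame_potential d m f) (\<lambda>G. G \<in> total_norm_seqs d m c) F" for F
  proof -
    have F: "F \<in> total_norm_seqs d m c" using min by (simp add: is_arg_min_def)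
    obtain G where G: "\<forall>k\<in>{1..m}. G k \<in> carrier_vec d"
      "\<forall>k\<in>{1..m}. (cvec_norm (G k))\<^sup>2 = (if k \<le> d then \<beta> else 0)"
      "\<forall>x\<in>carrier_vec d. frame_quad m G x = (\<Sum>i=1..d. \<beta> * (cmod (x \<bullet>c w i))\<^sup>2)"
      using scaled_basis_frame[OF w assms(2), of "\<lambda>_. \<beta>"] \<beta> by auto
    have "(\<Sum>k=1..m. (cvec_norm (G k))\<^sup>2) = (\<Sum>k=1..d. \<beta>)"
      using G(2) assms(2) by (intro sum.mono_neutral_cong_right) auto
    then have "G \<in> total_norm_seqs d m c" using G(1) \<beta> by (simp add: total_norm_seqs_def)
    then have "frame_potential d m f F \<le> frame_potential d m f G" using min by (force simp: is_arg_min_def)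
    also have "\<dots> \<le> (\<Sum>i=1..d. f \<beta>)"
      by (rule frame_potential_upper_bound[OF assms(3,1) G(1) w]) (use G(3) \<beta> in auto)
    finally have le: "frame_potential d m f F \<le> (\<Sum>i=1..d. f \<beta>)" .
    have "frame_quad m F x = \<beta> * (cvec_norm x)\<^sup>2" if "x \<in> carrier_vec d" for x
      by (rule frame_potential_lower_bound(2)[where r = 0 and \<mu> = "\<lambda>_. \<beta>", OF assms(3) A_carrier[OF F] w])
        (use \<beta> assms(1) A_norm[OF F] strict le that in \<open>auto intro: monotone_onI\<close>)
    then show ?thesis using A_carrier[OF F] \<beta> by (auto simp: tight_frame_def frame_quad_def)
  qed

  \<comment> \<open>Prescribed norms: the optimal spectrum \<open>\<mu>\<close> is \<open>a 1, \<dots>, a r, b, \<dots>, b\<close>, and the basis in the lower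
    bound is adapted to the frame.\<close>
  define r where "r = irregularity d m a"
  define b where "b = (\<Sum>i=r+1..m. a i) / real (d - r)"
  have apos: "\<And>i. i \<in> {1..m} \<Longrightarrow> 0 < a i" using assms(6) by blast
  note irr = irregularity_properties[OF assms(1,2) apos assms(7), folded r_def, folded b_def]
  have r: "r < d" by (rule irr(1))
  have b0: "0 < b" by (rule irr(2))
  have b_tail: "a i \<le> b" if "i \<in> {r+1..m}" for i by (rule irr(3)) (use that in auto)
  have b_head: "b \<le> a i" if "i \<in> {1..r}" for i by (rule irr(4)) (use that in auto)
  have b: "real (d - r) * b = (\<Sum>i=r+1..m. a i)" using r by (simp add: b_def)
  define \<mu> where "\<mu> i = (if i \<le> r then a i else b)" for i
  have \<mu>0: "0 < \<mu> i" if "i \<in> {1..d}" for i using apos[of i] that assms(2) b0 by (simp add: \<mu>_def)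
  have \<mu>_mono: "antimono_on {1..d} \<mu>"
  proof (rule monotone_onI)
    fix i j assume ij: "i \<in> {1..d}" "j \<in> {1..d}" "i \<le> j"
    show "\<mu> j \<le> \<mu> i"
    proof (cases "j \<le> r")
      case True
      then have "a j \<le> a i" using assms(7,2) ij by (simp add: monotone_on_def)
      then show ?thesis using True ij by (simp add: \<mu>_def)
    qed (use b_head ij in \<open>auto simp: \<mu>_def\<close>)
  qed
  have \<mu>_tail: "\<mu> i = \<mu> d" if "i \<in> {r+1..d}" for i using that r by (simp add: \<mu>_def)
  have \<mu>_sum: "(\<Sum>i=1..d. \<mu> i) = (\<Sum>i=1..m. a i)"
  proof -
    have "(\<Sum>i=1..d. \<mu> i) = (\<Sum>i=1..r. \<mu> i) + (\<Sum>i=r+1..d. \<mu> i)"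
      using sum.ub_add_nat[of 1 r \<mu> "d - r"] r by simp
    also have "\<dots> = (\<Sum>i=1..r. a i) + real (d - r) * b" by (simp add: \<mu>_def)
    also have "\<dots> = (\<Sum>i=1..m. a i)"
      unfolding b using sum.ub_add_nat[of 1 r a "m - r"] r assms(2) by simp
    finally show ?thesis .
  qed
  have B_carrier: "\<forall>i\<in>{1..m}. G i \<in> carrier_vec d" and B_norm: "\<And>i. i \<in> {1..m} \<Longrightarrow> (cvec_norm (G i))\<^sup>2 = a i"
    if "G \<in> prescribed_norm_seqs d m a" for G using that by (auto simp: prescribed_norm_seqs_def)
  have B_flag: "\<exists>u. orthonormal_on d {1..d} u \<and> (\<forall>i\<in>{1..d}. \<forall>j\<in>{1..<i}. G j \<bullet>c u i = 0) \<and>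
      (\<forall>j\<in>{1..r}. (\<Sum>i=1..j. \<mu> i) \<le> (\<Sum>i=1..j. frame_quad m G (u i)))"
    if G: "G \<in> prescribed_norm_seqs d m a" for G
  proof -
    have "G j \<in> carrier_vec d" if "j \<in> {1..<d}" for j using B_carrier[OF G] that assms(2) by auto
    then obtain u where u: "orthonormal_on d {1..d} u" "\<forall>i\<in>{1..d}. \<forall>j\<in>{1..<i}. G j \<bullet>c u i = 0"
      using flag_basis_exists[of d G] by blast
    have "(\<Sum>i=1..j. \<mu> i) \<le> (\<Sum>i=1..j. frame_quad m G (u i))" if j: "j \<in> {1..r}" for j
    proof -
      have "(\<Sum>i=1..j. \<mu> i) = (\<Sum>k=1..j. (cvec_norm (G k))\<^sup>2)"
        using j r assms(2) by (intro sum.cong refl) (simp add: \<mu>_def B_norm[OF G])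
      moreover have "0 \<le> (\<Sum>k=j+1..m. \<Sum>i=1..j. (cmod (G k \<bullet>c u i))\<^sup>2)" by (intro sum_nonneg) auto
      ultimately show ?thesis
        using flag_basis_partial_sums[OF B_carrier[OF G] u, of j] j r assms(2) by simp
    qed
    then show ?thesis using u by blast
  qed
  have B_total: "(\<Sum>i=1..d. \<mu> i) = (\<Sum>k=1..m. (cvec_norm (G k))\<^sup>2)"
    if G: "G \<in> prescribed_norm_seqs d m a" for G
    unfolding \<mu>_sum using B_norm[OF G] by (intro sum.cong) auto
  have B_lower: "(\<Sum>i=1..d. f (\<mu> i)) \<le> frame_potential d m f G" if G: "G \<in> prescribed_norm_seqs d m a" for G
  proof -
    obtain u where u: "orthonormal_on d {1..d} u"
      "\<forall>j\<in>{1..r}. (\<Sum>i=1..j. \<mu> i) \<le> (\<Sum>i=1..j. frame_quad m G (u i))"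
      using B_flag[OF G] by blast
    show ?thesis
      by (rule frame_potential_lower_bound(1)[OF assms(3) B_carrier[OF G] u(1) \<mu>0 \<mu>_mono r \<mu>_tail _ B_total[OF G]])
        (use u(2) in blast)+
  qed
  have B_min: "is_arg_min (frame_potential d m f) (\<lambda>G. G \<in> prescribed_norm_seqs d m a) F"
    if F: "F \<in> prescribed_norm_seqs d m a" and e: "orthonormal_basis d e" and can: "canonical_form d m a e F" for F e
  proof -
    have e': "orthonormal_on d {1..d} e" using e by (simp add: orthonormal_basis_def orthonormal_on_def)
    have "frame_quad m F x = (\<Sum>i=1..d. \<mu> i * (cmod (x \<bullet>c e i))\<^sup>2)" if "x \<in> carrier_vec d" for x
      unfolding \<mu>_def
      by (rule canonical_frame_quad[OF e' F less_imp_le[OF apos] assms(2) can r_def r b that]) simp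
    then have "frame_potential d m f F \<le> (\<Sum>i=1..d. f (\<mu> i))"
      using \<mu>0 by (intro frame_potential_upper_bound[OF assms(3,1) B_carrier[OF F] e'] less_imp_le) auto
    then show ?thesis using B_lower F by (force simp: is_arg_min_def)
  qed
  have B_unique: "\<exists>e. orthonormal_basis d e \<and> canonical_form d m a e F"
    if strict: "strictly_convex_on {0..} f"
      and min: "is_arg_min (frame_potential d m f) (\<lambda>G. G \<in> prescribed_norm_seqs d m a) F" for F
  proof -
    have F: "F \<in> prescribed_norm_seqs d m a" using min by (simp add: is_arg_min_def)
    have "\<exists>G\<in>prescribed_norm_seqs d m a.
        \<forall>x\<in>carrier_vec d. frame_quad m G x = (\<Sum>i=1..d. \<mu> i * (cmod (x \<bullet>c w i))\<^sup>2)"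
    proof (rule prescribed_norm_frame_exists[OF w assms(2) _ r])
      show "0 \<le> a i \<and> a i \<le> b" if "i \<in> {r+1..m}" for i using b_tail[OF that] apos[of i] that by auto
    qed (use \<mu>0 b in \<open>auto simp: \<mu>_def less_imp_le\<close>)
    then obtain G where G: "G \<in> prescribed_norm_seqs d m a"
      "\<And>x. x\<in>carrier_vec d \<Longrightarrow> frame_quad m G x = (\<Sum>i=1..d. \<mu> i * (cmod (x \<bullet>c w i))\<^sup>2)" by blast
    have "frame_potential d m f F \<le> frame_potential d m f G" using min G(1) by (force simp: is_arg_min_def)
    also have "\<dots> \<le> (\<Sum>i=1..d. f (\<mu> i))"
      by (rule frame_potential_upper_bound[OF assms(3,1) B_carrier[OF G(1)] w less_imp_le[OF \<mu>0] G(2)])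
    finally have le: "frame_potential d m f F \<le> (\<Sum>i=1..d. f (\<mu> i))" .
    obtain u where u: "orthonormal_on d {1..d} u" "\<forall>i\<in>{1..d}. \<forall>j\<in>{1..<i}. F j \<bullet>c u i = 0"
      "\<forall>j\<in>{1..r}. (\<Sum>i=1..j. \<mu> i) \<le> (\<Sum>i=1..j. frame_quad m F (u i))"
      using B_flag[OF F] by blast
    show ?thesis
    proof (rule canonical_form_of_spectrum[OF F assms(2) apos r_def r b0 u(1,2)])
      fix x \<gamma> assume x: "x \<in> carrier_vec d"
        and \<gamma>: "\<And>i. i \<in> {1..d} \<Longrightarrow> x \<bullet>c u i \<noteq> 0 \<Longrightarrow> (if i \<le> r then a i else b) = \<gamma>"
      show "frame_quad m F x = \<gamma> * (cvec_norm x)\<^sup>2"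
        by (rule frame_potential_lower_bound(2)[OF assms(3) B_carrier[OF F] u(1) \<mu>0 \<mu>_mono r \<mu>_tail _ B_total[OF F]
              strict le x \<gamma>[folded \<mu>_def]]) (use u(3) in blast)+
    qed
  qed
  show ?thesis using A_min A_unique B_min B_unique by blast
qed

end
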